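(* Let $k$ be a positive integer, let $p$ be an odd integer with $p\ge 3$, and let $\Delta_1,\ldots,\Delta_m$ be positive integers with $\Delta_i\ge p-1$ for all $i$ and $kp=\Delta_1+\cdots+ \Delta_m$. Let $G$ be a graph of even order satisfying $\Delta(G)\le \Delta_1+\cdots+ \Delta_m$ and let $V_1=\{v\in V(G): d_G(v)\ge kp-k+2\}$. If $G$ is $V_1$-partially odd-$(3k-3, V_1)$-edge-connected, then $G$ can be edge-decomposed into factors $G_1,\ldots, G_m$ satisfying $\Delta(G_i)\le \Delta_i$ for all $i$ with $1\le i \le m$.
   Context: Graphs may have loops and multiple edges; $d_G(v)$ is the degree of $v$ in $G$ (a loop counts twice), and $\Delta(G)$ is the maximum degree. A factor of $G$ is a spanning subgraph of $G$; $G$ is edge-decomposed into factors if their edge sets partition $E(G)$. For a vertex set $A$, $d_G(A)$ is the number of edges of $G$ with exactly one end in $A$. For vertex sets $W$ and $Q$, $G$ is $W$-partially odd-$(\lambda, Q)$-edge-connected if $d_G(A)\ge \lambda$ for all subsets $A$ of $W$ with $|A\cap Q|$ odd. *)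

theory Defs
  imports Main "HOL-Library.Uprod" "HOL-Library.Disjoint_Sets"
begin

text \<open>
  Finite undirected multigraphs. Every edge has an identity of its own, so parallel edges are
  distinct edges with the same ends; the ends are an unordered pair, with \<open>Upair v v\<close> for a loop
  at \<open>v\<close>.
\<close>

record ('v, 'e) mgraph =
  verts :: "'v set"
  edges :: "'e set"
  ends :: "'e \<Rightarrow> 'v uprod"

locale multigraph =
  fixes G :: "('v, 'e) mgraph"
  assumes finite_verts: "finite (verts G)"
    and finite_edges: "finite (edges G)"
    and ends_in_verts: "e \<in> edges G \<Longrightarrow> set_uprod (ends G e) \<subseteq> verts G"

text \<open>The second summand makes a loop count twice.\<close>

definition degree :: "('v, 'e) mgraph \<Rightarrow> 'v \<Rightarrow> nat" where
  "degree G v = card {e \<in> edges G. v \<in> set_uprod (ends G e)}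
     + card {e \<in> edges G. ends G e = Upair v v}"

text \<open>The \<open>0\<close> only matters for the graph without vertices.\<close>

definition max_degree :: "('v, 'e) mgraph \<Rightarrow> nat" where
  "max_degree G = Max (insert 0 (degree G ` verts G))"

definition cut_size :: "('v, 'e) mgraph \<Rightarrow> 'v set \<Rightarrow> nat" where
  "cut_size G A = card {e \<in> edges G. \<exists>u w. u \<in> A \<and> w \<notin> A \<and> ends G e = Upair u w}"

definition partially_odd_edge_connected ::
    "('v, 'e) mgraph \<Rightarrow> 'v set \<Rightarrow> nat \<Rightarrow> 'v set \<Rightarrow> bool" where
  "partially_odd_edge_connected G W l Q \<longleftrightarrow>
     (\<forall>A. A \<subseteq> W \<and> odd (card (A \<inter> Q)) \<longrightarrow> l \<le> cut_size G A)"

definition is_factor :: "('v, 'e) mgraph \<Rightarrow> ('v, 'e) mgraph \<Rightarrow> bool" where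
  "is_factor H G \<longleftrightarrow>
     verts H = verts G \<and> edges H \<subseteq> edges G \<and> (\<forall>e\<in>edges H. ends H e = ends G e)"

text \<open>A factor of the decomposition may have an empty edge set.\<close>

definition edge_decomposed_into ::
    "('v, 'e) mgraph \<Rightarrow> 'i set \<Rightarrow> ('i \<Rightarrow> ('v, 'e) mgraph) \<Rightarrow> bool" where
  "edge_decomposed_into G I H \<longleftrightarrow>
     (\<forall>i\<in>I. is_factor (H i) G) \<and>
     disjoint_family_on (\<lambda>i. edges (H i)) I \<and>
     (\<Union>i\<in>I. edges (H i)) = edges G"

end

theory Submission
  imports Defs
begin

text \<open>
  The edges are first coloured with \<open>k\<close> colours in such a way that all colour degrees (the degrees in
  the colour classes) are at most \<open>p\<close>. These classes are then rearranged. Each odd \<open>\<Delta> i\<close> is at least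
  \<open>p\<close> and receives one class; the remaining classes together have maximum degree at most an even number
  \<open>2 r\<close> and split into \<open>r\<close> classes of maximum degree 2, by Petersen's theorem, which are shared
  out (\<open>redistribute_classes\<close>).

  A bound \<open>p\<close> on the colour degrees follows from two qualitative properties of a colouring: the colour
  degrees at every vertex differ by at most 2, and those at the vertices of \<open>V\<^sub>1\<close> are odd. Outside
  \<open>V\<^sub>1\<close> a colour degree \<open>p + 1\<close> forces the degree up to at least \<open>(k - 1) (p - 1) + p + 1\<close>, that is
  \<open>k p - k + 2\<close>, which is just what the definition of \<open>V\<^sub>1\<close> excludes. In \<open>V\<^sub>1\<close> a colour degree that
  exceeds the odd number \<open>p\<close> is at least \<open>p + 2\<close>, all the others are at least \<open>p\<close>, and the degree
  exceeds \<open>k p\<close> (\<open>odd_degree_classes\<close>).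

  The two properties are obtained separately. Small differences can be achieved without changing any
  parity, by interchanging two colours along suitable trails (\<open>balanced_recolouring\<close>). So only the
  parities matter, and this is where the connectivity of the graph enters (\<open>parity_colouring\<close>): each
  colour class has to be a join for a set \<open>T\<close> that contains \<open>V\<^sub>1\<close>. The vertices outside \<open>T\<close> are removed by
  lifting pairs of edges, without making a cut with an odd number of vertices of \<open>T\<close> too small
  (\<open>liftable_pair\<close>). When only vertices of \<open>T\<close> are left, all degrees are large and the graph has so
  many edges that it contains \<open>k - 1\<close> edge-disjoint connected spanning subgraphs on some vertex set
  (\<open>dense_spanning_packing\<close>). This set can be contracted, since all parities inside it can be
  adjusted with the help of these subgraphs (\<open>extend_colouring\<close>).
\<close>

section \<open>Half-edges and weighted degrees\<close>

text \<open>
  In the combinatorial part a graph is an edge set with a function that gives the two ends of every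
  edge, indexed by \<open>bool\<close>. A pair of an edge and an index is a half-edge. Degrees count half-edges, so
  that loops count twice; the weights serve to compare two colours, one counting positively and the
  other negatively.
\<close>

definition wdeg :: "'e set \<Rightarrow> ('e \<Rightarrow> bool \<Rightarrow> 'v) \<Rightarrow> ('e \<Rightarrow> bool \<Rightarrow> int) \<Rightarrow> 'v \<Rightarrow> int" where
  "wdeg E a w v = (\<Sum>e\<in>E. (if a e True = v then w e True else 0) + (if a e False = v then w e False else 0))"

abbreviation dg :: "'e set \<Rightarrow> ('e \<Rightarrow> bool \<Rightarrow> 'v) \<Rightarrow> 'v \<Rightarrow> int" where
  "dg E a v \<equiv> wdeg E a (\<lambda>_ _. 1) v"

text \<open>
  Lifting: the half-edge \<open>(e, b)\<close> and the half-edge \<open>(e', b')\<close> at the same vertex are cut off, and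
  their edges are spliced into one edge, which keeps the name \<open>e\<close> and takes over the other end of
  \<open>e'\<close>. The same operation is applied to ends and to weights.
\<close>

definition merge :: "('e \<Rightarrow> bool \<Rightarrow> 'c) \<Rightarrow> 'e \<Rightarrow> bool \<Rightarrow> 'e \<Rightarrow> bool \<Rightarrow> 'e \<Rightarrow> bool \<Rightarrow> 'c" where
  "merge f e b e' b' = f(e := (f e)(b := f e' (\<not> b')))"

lemma merge_const: "merge (\<lambda>_ _. x) e b e' b' = (\<lambda>_ _. x)"
  by (auto simp: merge_def fun_eq_iff)

lemma wdeg_empty [simp]: "wdeg {} a w v = 0"
  by (simp add: wdeg_def)

lemma wdeg_insert:
  "finite E \<Longrightarrow> e \<notin> E \<Longrightarrow> wdeg (insert e E) a w v =
     (if a e True = v then w e True else 0) + (if a e False = v then w e False else 0) + wdeg E a w v"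
  by (simp add: wdeg_def)

lemma wdeg_remove:
  "finite E \<Longrightarrow> e \<in> E \<Longrightarrow> wdeg E a w v =
     (if a e True = v then w e True else 0) + (if a e False = v then w e False else 0) + wdeg (E - {e}) a w v"
  by (simp add: wdeg_def sum.remove)

lemma wdeg_Un:
  "finite A \<Longrightarrow> finite B \<Longrightarrow> A \<inter> B = {} \<Longrightarrow> wdeg (A \<union> B) a w v = wdeg A a w v + wdeg B a w v"
  by (simp add: wdeg_def sum.union_disjoint)

lemma wdeg_diff:
  "finite E \<Longrightarrow> D \<subseteq> E \<Longrightarrow> wdeg (E - D) a w v = wdeg E a w v - wdeg D a w v"
  by (simp add: wdeg_def sum_diff)

lemma wdeg_cong:
  "(\<And>e b. e \<in> E \<Longrightarrow> a e b = v \<longleftrightarrow> a' e b = v') \<Longrightarrow> (\<And>e b. e \<in> E \<Longrightarrow> a e b = v \<Longrightarrow> w e b = w' e b) \<Longrightarrow>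
   wdeg E a w v = wdeg E a' w' v'"
  unfolding wdeg_def by (intro sum.cong) auto

lemma wdeg_untouched:
  "(\<And>e b. e \<in> E \<Longrightarrow> a e b \<noteq> v) \<Longrightarrow> wdeg E a w v = 0"
  unfolding wdeg_def by (intro sum.neutral) auto

lemma dg_nonneg: "0 \<le> dg E a v"
  unfolding wdeg_def by (intro sum_nonneg) auto

lemma dg_mono: "finite E \<Longrightarrow> D \<subseteq> E \<Longrightarrow> dg D a v \<le> dg E a v"
  unfolding wdeg_def by (intro sum_mono2) auto

lemma dg_pos: "finite E \<Longrightarrow> e \<in> E \<Longrightarrow> a e b = v \<Longrightarrow> 1 \<le> dg E a v"
  using dg_nonneg[of "E - {e}" a v] by (cases b) (auto simp: wdeg_remove[of E e])

lemma dg_touched: "dg E a v \<noteq> 0 \<Longrightarrow> \<exists>e\<in>E. \<exists>b. a e b = v"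
  using wdeg_untouched[of E a v] by metis

text \<open>
  A set of edges of the spliced graph is read in the original graph by replacing the spliced edge by
  its two pieces; only the vertex of the splice can notice the difference.
\<close>

lemma wdeg_merge:
  assumes "finite D" "e' \<notin> D" "a e b = u" "a e' b' = u"
  shows "wdeg (if e \<in> D then insert e' D else D) a w z =
     wdeg D (merge a e b e' b') (merge w e b e' b') z + (if e \<in> D \<and> z = u then w e b + w e' b' else 0)"
proof (cases "e \<in> D")
  case True
  have *: "wdeg (D - {e}) (merge a e b e' b') (merge w e b e' b') z = wdeg (D - {e}) a w z"
    by (rule wdeg_cong) (auto simp: merge_def)
  have 1: "wdeg D (merge a e b e' b') (merge w e b e' b') z =
      (if merge a e b e' b' e True = z then merge w e b e' b' e True else 0) +
      (if merge a e b e' b' e False = z then merge w e b e' b' e False else 0) + wdeg (D - {e}) a w z"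
    unfolding wdeg_remove[OF assms(1) True] * ..
  have 2: "wdeg (insert e' D) a w z = (if a e' True = z then w e' True else 0) +
      (if a e' False = z then w e' False else 0) + ((if a e True = z then w e True else 0) +
      (if a e False = z then w e False else 0) + wdeg (D - {e}) a w z)"
    unfolding wdeg_insert[OF assms(1,2)] wdeg_remove[OF assms(1) True] ..
  show ?thesis
    unfolding if_P[OF True] 1 2 using True assms(3,4)
    by (cases b; cases b') (simp_all add: merge_def)
next
  case False
  have "wdeg D (merge a e b e' b') (merge w e b e' b') z = wdeg D a w z"
    by (rule wdeg_cong) (use False in \<open>auto simp: merge_def\<close>)
  then show ?thesis using False by simp
qed

lemma dg_merge:
  assumes "finite D" "e' \<notin> D" "a e b = u" "a e' b' = u"
  shows "dg (if e \<in> D then insert e' D else D) a z =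
     dg D (merge a e b e' b') z + (if e \<in> D \<and> z = u then 2 else 0)"
  using wdeg_merge[OF assms, of "\<lambda>_ _. 1" z] by (simp add: merge_const)

lemma even_wdeg_sign:
  assumes "\<And>e b. e \<in> E \<Longrightarrow> odd (w e b)"
  shows "even (wdeg E a w v) \<longleftrightarrow> even (dg E a v)"
proof -
  have "even (wdeg E a w v - dg E a v)"
    unfolding wdeg_def sum_subtractf[symmetric] by (rule dvd_sum) (use assms in auto)
  then show ?thesis by presburger
qed

section \<open>Balanced recolourings\<close>

text \<open>
  In a graph with even degrees this is a closed trail that leaves \<open>v\<close> along \<open>e\<close> and stops at the first
  return to \<open>v\<close>; at a vertex of odd degree a trail may also end. Splicing half-edges in pairs at all
  vertices other than \<open>v\<close> makes the trail a set of at most two edges, which avoids walking along it.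
\<close>

lemma short_closed_trail:
  assumes "finite L" "e \<in> L" "a e b = v"
  shows "\<exists>D\<subseteq>L. e \<in> D \<and> (\<forall>u. even (dg L a u) \<longrightarrow> even (dg D a u)) \<and> dg D a v \<le> 2"
  using assms
proof (induction "card L" arbitrary: L a rule: less_induct)
  case less
  note fin = \<open>finite L\<close> and eL = \<open>e \<in> L\<close> and eb = \<open>a e b = v\<close>
  consider (loop) "a e True = a e False"
    | (other) l where "a e True \<noteq> a e False" "l \<in> L" "l \<noteq> e" "a l True = a l False"
    | (lift) l l' c c' u where "a e True \<noteq> a e False" "l \<in> L" "l' \<in> L" "l \<noteq> l'" "l' \<noteq> e" 
         "u \<noteq> v" "a l c = u" "a l' c' = u"
    | (fin) "\<And>l. l \<in> L \<Longrightarrow> a l True \<noteq> a l False"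
        "\<And>l l' c c'. l \<in> L \<Longrightarrow> l' \<in> L \<Longrightarrow> a l c = a l' c' \<Longrightarrow> a l c \<noteq> v \<Longrightarrow> l = l'"
    by metis
  then show ?case
  proof cases
    case loop
    then show ?thesis using eL
      by (intro exI[of _ "{e}"]) (auto simp: wdeg_insert)
  next
    case other
    have "card (L - {l}) < card L" by (rule card_Diff1_less[OF fin other(2)])
    from less.hyps[OF this, of a] obtain D where D: "D \<subseteq> L - {l}" "e \<in> D"
      "\<forall>u. even (dg (L - {l}) a u) \<longrightarrow> even (dg D a u)" "dg D a v \<le> 2"
      using fin eL eb other(3) by auto
    have "even (dg L a u) \<longleftrightarrow> even (dg (L - {l}) a u)" for u
      using other by (simp add: wdeg_remove[OF fin other(2)])
    then show ?thesis using D by (intro exI[of _ D]) auto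
  next
    case lift
    let ?a = "merge a l c l' c'"
    have "card (L - {l'}) < card L" by (rule card_Diff1_less[OF fin lift(3)])
    moreover have "?a e b = v" using lift eb by (auto simp: merge_def)
    ultimately obtain D where D: "D \<subseteq> L - {l'}" "e \<in> D"
      "\<forall>u. even (dg (L - {l'}) ?a u) \<longrightarrow> even (dg D ?a u)" "dg D ?a v \<le> 2"
      using less.hyps[of "L - {l'}" ?a] fin eL lift(5) by auto
    have finD: "finite D" and l'D: "l' \<notin> D" using D(1) fin finite_subset by auto
    let ?D = "if l \<in> D then insert l' D else D"
    have L: "dg L a z = dg (L - {l'}) ?a z + (if z = u then 2 else 0)" for z
      using dg_merge[of "L - {l'}" l' a l c u c' z] fin lift by (auto simp: insert_absorb)
    have DD: "dg ?D a z = dg D ?a z + (if l \<in> D \<and> z = u then 2 else 0)" for z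
      by (rule dg_merge[OF finD l'D]) (use lift in auto)
    show ?thesis
    proof (intro exI[of _ ?D] conjI allI impI)
      show "?D \<subseteq> L" using D(1) lift by auto
      show "e \<in> ?D" using D(2) by auto
      show "dg ?D a v \<le> 2" using D(4) DD[of v] lift(6) by simp
      show "even (dg ?D a z)" if "even (dg L a z)" for z
        using that D(3) unfolding L DD by (auto split: if_splits)
    qed
  next
    case fin
    define x where "x = a e (\<not> b)"
    have xv: "x \<noteq> v" using fin(1)[OF eL] eb by (cases b) (auto simp: x_def)
    have one: "dg L a (a l c) = 1" if l: "l \<in> L" "a l c \<noteq> v" for l c
    proof -
      have "dg (L - {l}) a (a l c) = 0"
        by (rule wdeg_untouched) (use fin(2) l in fastforce)
      then show ?thesis using fin(1)[OF l(1)] l(1) less.prems(1)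
        by (cases c) (auto simp: wdeg_remove[of L l])
    qed
    \<comment> \<open>Nothing can be spliced any more, so that every vertex other than \<open>v\<close> has degree at most 1.\<close>
    have ox: "odd (dg L a x)" using one[OF eL, of "\<not> b"] xv by (simp add: x_def)
    have de: "dg {e} a z = (if z = v \<or> z = x then 1 else 0)" for z
      using eb xv by (cases b) (auto simp: wdeg_insert x_def)
    show ?thesis
    proof (cases "odd (dg L a v)")
      case True
      then show ?thesis using eL ox de by (intro exI[of _ "{e}"]) auto
    next
      case False
      have "dg L a v = 1 + dg (L - {e}) a v" 
        using de[of v] wdeg_remove[OF less.prems(1) eL, of a "\<lambda>_ _. 1" v] by (simp add: wdeg_insert)
      with False have "dg (L - {e}) a v \<noteq> 0" by auto
      then obtain l c where l: "l \<in> L" "l \<noteq> e" "a l c = v" using dg_touched by fastforce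
      define y where "y = a l (\<not> c)"
      have yv: "y \<noteq> v" using fin(1)[OF l(1)] l(3) by (cases c) (auto simp: y_def)
      have oy: "odd (dg L a y)" using one[OF l(1), of "\<not> c"] yv by (simp add: y_def)
      have dl: "dg {l} a z = (if z = v \<or> z = y then 1 else 0)" for z
        using l(3) yv by (cases c) (auto simp: wdeg_insert y_def)
      have "dg {e, l} a z = dg {e} a z + dg {l} a z" for z
        using l(2) by (simp add: wdeg_def)
      moreover have "x \<noteq> y" using fin(2)[OF eL l(1), of "\<not> b" "\<not> c"] l(2) xv by (auto simp: x_def y_def)
      ultimately show ?thesis using eL l(1) ox oy de dl xv yv
        by (intro exI[of _ "{e, l}"]) auto
    qed
  qed
qed

lemma wdeg_sign_uniform:
  assumes "\<And>e b. e \<in> E \<Longrightarrow> a e b = v \<Longrightarrow> w e b = \<sigma>"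
  shows "wdeg E a w v = \<sigma> * dg E a v"
  unfolding wdeg_def sum_distrib_left by (intro sum.cong) (use assms in auto)

text \<open>
  Half-edges of opposite signs at a vertex cancel and are spliced, which does not change any weighted
  degree. When this is exhausted, the signs at each vertex agree, and then reversing the signs on an
  arbitrary edge set cannot increase the absolute value of a weighted degree. It remains to find an
  edge set that respects the parities and uses some, but not all, of the at least 3 half-edges at
  \<open>v\<close>; a short closed trail does.
\<close>

lemma improving_flip:
  fixes s :: "'e \<Rightarrow> bool \<Rightarrow> int"
  assumes "finite L" "\<And>e b. s e b = 1 \<or> s e b = -1" "3 \<le> \<bar>wdeg L a s v\<bar>"
  shows "\<exists>D\<subseteq>L. (\<forall>u. even (dg L a u) \<longrightarrow> even (dg D a u)) \<and>
      (\<forall>u. \<bar>wdeg L a s u - 2 * wdeg D a s u\<bar> \<le> \<bar>wdeg L a s u\<bar>) \<and>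
      \<bar>wdeg L a s v - 2 * wdeg D a s v\<bar> < \<bar>wdeg L a s v\<bar>"
  using assms
proof (induction "card L" arbitrary: L a s rule: less_induct)
  case less
  note fin = \<open>finite L\<close> and sgn = less.prems(2) and big = less.prems(3)
  consider (loop) l where "l \<in> L" "a l True = a l False" "s l True \<noteq> s l False"
    | (lift) l l' c c' where "l \<in> L" "l' \<in> L" "l \<noteq> l'" "a l c = a l' c'" "s l c \<noteq> s l' c'"
    | (fin) "\<And>l l' c c'. l \<in> L \<Longrightarrow> l' \<in> L \<Longrightarrow> a l c = a l' c' \<Longrightarrow> s l c = s l' c'"
    by (metis (full_types))
  then show ?case
  proof cases
    case loop
    have c: "card (L - {l}) < card L" by (rule card_Diff1_less[OF fin loop(1)])
    have 0: "s l True + s l False = 0" using loop(3) sgn[of l True] sgn[of l False] by auto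
    have w: "wdeg L a s u = wdeg (L - {l}) a s u" for u
      using loop 0 by (auto simp: wdeg_remove[OF fin loop(1)])
    have d: "even (dg L a u) \<longleftrightarrow> even (dg (L - {l}) a u)" for u
      using loop by (simp add: wdeg_remove[OF fin loop(1)])
    obtain D where "D \<subseteq> L - {l}" "\<forall>u. even (dg (L - {l}) a u) \<longrightarrow> even (dg D a u)"
      "\<forall>u. \<bar>wdeg (L - {l}) a s u - 2 * wdeg D a s u\<bar> \<le> \<bar>wdeg (L - {l}) a s u\<bar>"
      "\<bar>wdeg (L - {l}) a s v - 2 * wdeg D a s v\<bar> < \<bar>wdeg (L - {l}) a s v\<bar>"
      using less.hyps[OF c, of s a] fin sgn big w by auto
    then show ?thesis using w d by (intro exI[of _ D]) auto
  next
    case lift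
    let ?a = "merge a l c l' c'" and ?s = "merge s l c l' c'"
    have c: "card (L - {l'}) < card L" by (rule card_Diff1_less[OF fin lift(2)])
    have sgn': "?s e b = 1 \<or> ?s e b = -1" for e b using sgn by (auto simp: merge_def)
    have 0: "s l c + s l' c' = 0" using lift(5) sgn[of l c] sgn[of l' c'] by auto
    have w: "wdeg (if l \<in> D then insert l' D else D) a s z = wdeg D ?a ?s z" 
      if "finite D" "l' \<notin> D" for D z
      using wdeg_merge[OF that, of a l c _ c' s z] lift(4) 0 by (auto split: if_splits)
    have d: "even (dg (if l \<in> D then insert l' D else D) a z) \<longleftrightarrow> even (dg D ?a z)" 
      if "finite D" "l' \<notin> D" for D z
      using dg_merge[OF that, of a l c _ c' z] lift(4) by (auto split: if_splits)
    have L: "L = (if l \<in> L - {l'} then insert l' (L - {l'}) else L - {l'})" using lift by auto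
    have wL: "wdeg L a s z = wdeg (L - {l'}) ?a ?s z" and dL: "even (dg L a z) \<longleftrightarrow> even (dg (L - {l'}) ?a z)" for z
      using w[of "L - {l'}" z] d[of "L - {l'}" z] L fin by auto
    obtain D where D: "D \<subseteq> L - {l'}" "\<forall>u. even (dg (L - {l'}) ?a u) \<longrightarrow> even (dg D ?a u)"
      "\<forall>u. \<bar>wdeg (L - {l'}) ?a ?s u - 2 * wdeg D ?a ?s u\<bar> \<le> \<bar>wdeg (L - {l'}) ?a ?s u\<bar>"
      "\<bar>wdeg (L - {l'}) ?a ?s v - 2 * wdeg D ?a ?s v\<bar> < \<bar>wdeg (L - {l'}) ?a ?s v\<bar>"
      using less.hyps[OF c, of ?s ?a] fin sgn' big wL by auto
    have fD: "finite D" "l' \<notin> D" using D(1) fin finite_subset by auto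
    show ?thesis using D w[OF fD] d[OF fD] wL dL lift(2)
      by (intro exI[of _ "if l \<in> D then insert l' D else D"]) auto
  next
    case fin
    have "\<exists>\<sigma>. (\<sigma> = 1 \<or> \<sigma> = -1) \<and> (\<forall>e\<in>L. \<forall>b. a e b = u \<longrightarrow> s e b = \<sigma>)" for u
      using fin sgn by metis
    then obtain \<sigma> where \<sigma>: "\<And>u. \<sigma> u = 1 \<or> \<sigma> u = (-1::int)" "\<And>u e b. e \<in> L \<Longrightarrow> a e b = u \<Longrightarrow> s e b = \<sigma> u"
      by metis
    have w: "wdeg D a s u = \<sigma> u * dg D a u" if "D \<subseteq> L" for D u
      by (rule wdeg_sign_uniform) (use \<sigma> that in auto)
    have abs: "\<bar>\<sigma> u * x\<bar> = \<bar>x\<bar>" for u x using \<sigma>(1)[of u] by auto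
    have wv: "3 \<le> dg L a v" using big w[of L v] abs dg_nonneg[of L a v] by simp
    then obtain e b where e: "e \<in> L" "a e b = v" using dg_touched[of L a v] by auto
    obtain D where D: "D \<subseteq> L" "e \<in> D" "\<forall>u. even (dg L a u) \<longrightarrow> even (dg D a u)" "dg D a v \<le> 2"
      using short_closed_trail[of L e a b v, OF less.prems(1) e] by blast
    have diff: "\<bar>wdeg L a s u - 2 * wdeg D a s u\<bar> = \<bar>dg L a u - 2 * dg D a u\<bar>" for u
      using w[OF D(1), of u] w[of L u] abs[of u "dg L a u - 2 * dg D a u"] by (simp add: algebra_simps)
    have wL: "\<bar>wdeg L a s u\<bar> = dg L a u" for u using w[of L u] abs dg_nonneg[of L a u] by simp
    note m = dg_mono[OF less.prems(1) D(1), of a] dg_nonneg[of D a]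
    have "1 \<le> dg D a v" using dg_pos D(1,2) e(2) less.prems(1) finite_subset by metis
    then have "\<bar>dg L a v - 2 * dg D a v\<bar> < dg L a v" using D(4) wv by linarith
    moreover have "\<bar>dg L a u - 2 * dg D a u\<bar> \<le> dg L a u" for u using m[of u] by linarith
    ultimately show ?thesis using D(1,3) by (intro exI[of _ D]) (simp add: diff wL)
  qed
qed

text \<open>
  Two colours that differ by at least 3 at a vertex can be interchanged along an improving set of
  edges. This decreases the sum of the squares of all colour degrees, because the sum of the two
  colour degrees is unchanged at every vertex. At the vertices of \<open>S\<close> the two colour degrees have the
  same parity, hence the two colours together have even degree there, the improving set has even
  degree too, and the interchange preserves parities.
\<close>

lemma balanced_recolouring:
  fixes c :: "'e \<Rightarrow> nat" and a :: "'e \<Rightarrow> bool \<Rightarrow> 'v"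
  assumes "finite E" "\<And>e. e \<in> E \<Longrightarrow> c e < k"
    and "\<And>v i j. v \<in> S \<Longrightarrow> i < k \<Longrightarrow> j < k \<Longrightarrow> even (dg {e \<in> E. c e = i} a v) \<longleftrightarrow> even (dg {e \<in> E. c e = j} a v)"
  shows "\<exists>c'. (\<forall>e\<in>E. c' e < k) \<and>
     (\<forall>v\<in>S. \<forall>i<k. even (dg {e \<in> E. c' e = i} a v) \<longleftrightarrow> even (dg {e \<in> E. c e = i} a v)) \<and>
     (\<forall>v. \<forall>i<k. \<forall>j<k. \<bar>dg {e \<in> E. c' e = i} a v - dg {e \<in> E. c' e = j} a v\<bar> \<le> 2)"
proof -
  define W where "W = (\<Union>e\<in>E. range (a e))"
  have finW: "finite W" using assms(1) by (auto simp: W_def)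
  define d where "d c i v = dg {e \<in> E. c e = i} a v" for c :: "'e \<Rightarrow> nat" and i v
  define \<Phi> where "\<Phi> c = nat (\<Sum>v\<in>W. \<Sum>i<k. (d c i v)\<^sup>2)" for c
  show ?thesis unfolding d_def[symmetric]
    using assms(2,3) unfolding d_def[symmetric]
  proof (induction "\<Phi> c" arbitrary: c rule: less_induct)
    case less
    note ck = less.prems(1) and par = less.prems(2)
    show ?case
    proof (cases "\<exists>v i j. i < k \<and> j < k \<and> 2 < \<bar>d c i v - d c j v\<bar>")
      case False
      then have "\<bar>d c i v - d c j v\<bar> \<le> 2" if "i < k" "j < k" for v i j
        using that by (meson not_less)
      then show ?thesis using ck by (intro exI[of _ c]) simp
    next
      case True
      then obtain v i j where ij: "i < k" "j < k" "2 < \<bar>d c i v - d c j v\<bar>" by blast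
      then have ij3: "3 \<le> \<bar>d c i v - d c j v\<bar>" by linarith
      have ne: "i \<noteq> j" using ij(3) by auto
      define L where "L = {e \<in> E. c e = i \<or> c e = j}"
      define s where "s e b = (if c e = i then 1 else -1 :: int)" for e and b :: bool
      have finL: "finite L" using assms(1) by (simp add: L_def)
      have split: "wdeg D a s u = dg {e \<in> D. c e = i} a u - dg {e \<in> D. c e = j} a u" if "D \<subseteq> L" for D u
      proof -
        have fD: "finite D" using that finL finite_subset by auto
        have "D = {e \<in> D. c e = i} \<union> {e \<in> D. c e = j}" using that by (auto simp: L_def)
        then have "wdeg D a s u = wdeg {e \<in> D. c e = i} a s u + wdeg {e \<in> D. c e = j} a s u"
          using wdeg_Un[of "{e \<in> D. c e = i}" "{e \<in> D. c e = j}" a s u] fD ne by auto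
        moreover have "wdeg {e \<in> D. c e = i} a s u = 1 * dg {e \<in> D. c e = i} a u"
          by (rule wdeg_sign_uniform) (auto simp: s_def)
        moreover have "wdeg {e \<in> D. c e = j} a s u = -1 * dg {e \<in> D. c e = j} a u"
          by (rule wdeg_sign_uniform) (use ne in \<open>auto simp: s_def\<close>)
        ultimately show ?thesis by simp
      qed
      have LE: "{e \<in> L. c e = i} = {e \<in> E. c e = i}" "{e \<in> L. c e = j} = {e \<in> E. c e = j}"
        by (auto simp: L_def)
      have wL: "wdeg L a s u = d c i u - d c j u" for u
        using split[of L u] LE by (simp add: d_def)
      have sg: "s e b = 1 \<or> s e b = -1" for e b by (simp add: s_def)
      have big: "3 \<le> \<bar>wdeg L a s v\<bar>" using ij3 wL by simp
      obtain D where D: "D \<subseteq> L" "\<forall>u. even (dg L a u) \<longrightarrow> even (dg D a u)"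
        "\<forall>u. \<bar>wdeg L a s u - 2 * wdeg D a s u\<bar> \<le> \<bar>wdeg L a s u\<bar>"
        "\<bar>wdeg L a s v - 2 * wdeg D a s v\<bar> < \<bar>wdeg L a s v\<bar>"
        using improving_flip[OF finL sg big] by blast
      define c' where "c' e = (if e \<in> D then if c e = i then j else i else c e)" for e
      define \<delta> where "\<delta> u = wdeg D a s u" for u
      have finD: "finite D" using D(1) finL finite_subset by auto
      have DE: "D \<subseteq> E" and Dc: "\<And>e. e \<in> D \<Longrightarrow> c e = i \<or> c e = j" using D(1) by (auto simp: L_def)
      have mv: "dg ({e \<in> E. c e = x} - {e \<in> D. c e = x} \<union> {e \<in> D. c e = y}) a u
          = d c x u - dg {e \<in> D. c e = x} a u + dg {e \<in> D. c e = y} a u" if "x \<noteq> y" for x y u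
      proof -
        have "dg ({e \<in> E. c e = x} - {e \<in> D. c e = x} \<union> {e \<in> D. c e = y}) a u =
          dg ({e \<in> E. c e = x} - {e \<in> D. c e = x}) a u + dg {e \<in> D. c e = y} a u"
          by (rule wdeg_Un) (use assms(1) finD that in auto)
        also have "dg ({e \<in> E. c e = x} - {e \<in> D. c e = x}) a u = d c x u - dg {e \<in> D. c e = x} a u"
          unfolding d_def by (rule wdeg_diff) (use assms(1) DE in auto)
        finally show ?thesis .
      qed
      have "{e \<in> E. c' e = i} = {e \<in> E. c e = i} - {e \<in> D. c e = i} \<union> {e \<in> D. c e = j}"
        using DE Dc ne by (auto simp: c'_def)
      then have di: "d c' i u = d c i u - \<delta> u" for u
        using mv[OF ne, of u] split[OF D(1), of u] by (simp add: d_def \<delta>_def)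
      have "{e \<in> E. c' e = j} = {e \<in> E. c e = j} - {e \<in> D. c e = j} \<union> {e \<in> D. c e = i}"
        using DE Dc ne by (auto simp: c'_def)
      then have dj: "d c' j u = d c j u + \<delta> u" for u
        using mv[of j i u] ne split[OF D(1), of u] by (simp add: d_def \<delta>_def)
      have dl: "d c' l u = d c l u" if "l \<noteq> i" "l \<noteq> j" for l u
      proof -
        have "{e \<in> E. c' e = l} = {e \<in> E. c e = l}" using Dc that by (auto simp: c'_def)
        then show ?thesis by (simp add: d_def)
      qed
      have ck': "c' e < k" if "e \<in> E" for e using ck[OF that] ij by (auto simp: c'_def)
      have ev\<delta>: "even (\<delta> u)" if "u \<in> S" for u
      proof -
        have "even (wdeg L a s u) \<longleftrightarrow> even (dg L a u)" and "even (\<delta> u) \<longleftrightarrow> even (dg D a u)"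
          unfolding \<delta>_def by (rule even_wdeg_sign; simp add: s_def)+
        then show ?thesis using D(2) wL[of u] par[OF that ij(1,2)] by auto
      qed
      have same: "even (d c' l u) \<longleftrightarrow> even (d c l u)" if "u \<in> S" for l u
        using ev\<delta>[OF that] di[of u] dj[of u] dl[of l u] by (cases "l = i"; cases "l = j") auto
      have rest: "(\<Sum>l<k. (d c' l u)\<^sup>2) - (\<Sum>l<k. (d c l u)\<^sup>2) = 
          (d c' i u)\<^sup>2 - (d c i u)\<^sup>2 + ((d c' j u)\<^sup>2 - (d c j u)\<^sup>2)" for u
      proof -
        have "(\<Sum>l<k. (d c' l u)\<^sup>2) - (\<Sum>l<k. (d c l u)\<^sup>2) = (\<Sum>l<k. (d c' l u)\<^sup>2 - (d c l u)\<^sup>2)"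
          by (simp add: sum_subtractf)
        also have "\<dots> = (\<Sum>l\<in>{i,j}. (d c' l u)\<^sup>2 - (d c l u)\<^sup>2)"
          by (rule sum.mono_neutral_right) (use ij dl in auto)
        finally show ?thesis using ne by simp
      qed
      have sq: "2 * ((\<Sum>l<k. (d c' l u)\<^sup>2) - (\<Sum>l<k. (d c l u)\<^sup>2))
          = (wdeg L a s u - 2 * wdeg D a s u)\<^sup>2 - (wdeg L a s u)\<^sup>2" for u
        unfolding rest di dj wL \<delta>_def by (simp add: power2_eq_square algebra_simps)
      have le: "(\<Sum>l<k. (d c' l u)\<^sup>2) \<le> (\<Sum>l<k. (d c l u)\<^sup>2)" for u
        using sq[of u] D(3) abs_le_square_iff[of "wdeg L a s u - 2 * wdeg D a s u" "wdeg L a s u"] by auto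
      have lt: "(\<Sum>l<k. (d c' l v)\<^sup>2) < (\<Sum>l<k. (d c l v)\<^sup>2)"
        using sq[of v] power_strict_mono[OF D(4), of 2] by simp
      have "dg L a v \<noteq> 0"
      proof
        assume "dg L a v = 0"
        then have "d c i v = 0" "d c j v = 0"
          using dg_mono[OF finL, of "{e \<in> E. c e = i}" a v] dg_mono[OF finL, of "{e \<in> E. c e = j}" a v]
            dg_nonneg[of "{e \<in> E. c e = i}" a v] dg_nonneg[of "{e \<in> E. c e = j}" a v]
          by (auto simp: d_def L_def)
        then show False using ij(3) by simp
      qed
      then have vW: "v \<in> W" using dg_touched[of L a v] by (auto simp: W_def L_def)
      have "(\<Sum>v\<in>W. \<Sum>i<k. (d c' i v)\<^sup>2) < (\<Sum>v\<in>W. \<Sum>i<k. (d c i v)\<^sup>2)"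
        by (rule sum_strict_mono_ex1) (use finW le lt vW in auto)
      moreover have "0 \<le> (\<Sum>v\<in>W. \<Sum>i<k. (d c' i v)\<^sup>2)" by (intro sum_nonneg) auto
      ultimately have "\<Phi> c' < \<Phi> c" by (simp add: \<Phi>_def)
      from less.hyps[OF this] obtain c'' where c'': "\<forall>e\<in>E. c'' e < k" 
        "\<forall>v\<in>S. \<forall>i<k. even (d c'' i v) = even (d c' i v)" 
        "\<forall>v. \<forall>i<k. \<forall>j<k. \<bar>d c'' i v - d c'' j v\<bar> \<le> 2"
        using ck' same par by metis
      then show ?thesis using same by (intro exI[of _ c'']) auto
    qed
  qed
qed

section \<open>Disjoint connected subgraphs of dense graphs\<close>

definition adj :: "('e \<Rightarrow> bool \<Rightarrow> 'v) \<Rightarrow> 'e set \<Rightarrow> ('v \<times> 'v) set" where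
  "adj a X = {(a e b, a e (\<not> b)) |e b. e \<in> X}"

abbreviation conn :: "('e \<Rightarrow> bool \<Rightarrow> 'v) \<Rightarrow> 'e set \<Rightarrow> ('v \<times> 'v) set" where
  "conn a X \<equiv> (adj a X)\<^sup>*"

abbreviation spans :: "('e \<Rightarrow> bool \<Rightarrow> 'v) \<Rightarrow> 'e set \<Rightarrow> 'e \<Rightarrow> bool" where
  "spans a X e \<equiv> (a e True, a e False) \<in> conn a X"

definition forest :: "('e \<Rightarrow> bool \<Rightarrow> 'v) \<Rightarrow> 'e set \<Rightarrow> bool" where
  "forest a X \<longleftrightarrow> (\<forall>e\<in>X. \<not> spans a (X - {e}) e)"

lemma conn_sym: "(x, y) \<in> conn a X \<Longrightarrow> (y, x) \<in> conn a X"
proof -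
  have "(y, x) \<in> adj a X" if xy: "(x, y) \<in> adj a X" for x y
  proof -
    obtain e b where "e \<in> X" "x = a e b" "y = a e (\<not> b)" using xy by (auto simp: adj_def)
    then have "(y, x) = (a e (\<not> b), a e (\<not> \<not> b))" "e \<in> X" by auto
    then show ?thesis unfolding adj_def by blast
  qed
  then have "sym (conn a X)" by (intro sym_rtrancl symI)
  then show "(x, y) \<in> conn a X \<Longrightarrow> (y, x) \<in> conn a X" by (rule symD)
qed

lemma conn_mono: "X \<subseteq> Y \<Longrightarrow> conn a X \<subseteq> conn a Y"
  by (intro rtrancl_mono) (auto simp: adj_def)

lemma conn_edge: "e \<in> X \<Longrightarrow> (a e b, a e (\<not> b)) \<in> conn a X"
  by (intro r_into_rtrancl) (auto simp: adj_def)

lemma spans_edge: "spans a X e \<Longrightarrow> (a e b, a e (\<not> b)) \<in> conn a X"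
  using conn_sym[of "a e True" "a e False" a X] by (cases b) auto

lemma conn_subset: "(\<And>e. e \<in> Y \<Longrightarrow> spans a X e) \<Longrightarrow> conn a Y \<subseteq> conn a X"
proof (intro rtrancl_subset_rtrancl subrelI)
  fix x y
  assume sp: "\<And>e. e \<in> Y \<Longrightarrow> spans a X e" and "(x, y) \<in> adj a Y"
  then obtain e b where "e \<in> Y" "x = a e b" "y = a e (\<not> b)" by (auto simp: adj_def)
  then show "(x, y) \<in> conn a X" using spans_edge[OF sp, of e b] by simp
qed

lemma conn_insertD:
  assumes "(x, y) \<in> conn a (insert e X)"
  shows "(x, y) \<in> conn a X \<or> (\<exists>b. (x, a e b) \<in> conn a X \<and> (a e (\<not> b), y) \<in> conn a X)"
  using assms
proof (induction rule: rtrancl_induct)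
  case base
  then show ?case by simp
next
  case (step y z)
  from step.hyps(2) consider "(y, z) \<in> adj a X" | b where "y = a e b" "z = a e (\<not> b)"
    by (auto simp: adj_def)
  then show ?case
  proof cases
    case 1
    then show ?thesis using step.IH by (meson rtrancl.rtrancl_into_rtrancl)
  next
    case 2
    from step.IH show ?thesis
    proof
      assume "(x, y) \<in> conn a X"
      then show ?thesis using 2 by auto
    next
      assume "\<exists>b. (x, a e b) \<in> conn a X \<and> (a e (\<not> b), y) \<in> conn a X"
      then obtain b' where b': "(x, a e b') \<in> conn a X" "(a e (\<not> b'), y) \<in> conn a X" by auto
      show ?thesis
      proof (cases "b' = b")
        case True
        then show ?thesis using b' 2 by auto
      next
        case False
        then have "z = a e b'" using 2 by (cases b; cases b') auto
        then show ?thesis using b' by auto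
      qed
    qed
  qed
qed

text \<open>
  The exchange property of the closure operator of the graphic matroid.
\<close>

lemma spans_exchange:
  assumes "spans a (insert f X) e" "\<not> spans a X e"
  shows "spans a (insert e X) f"
proof -
  obtain b where b: "(a e True, a f b) \<in> conn a X" "(a f (\<not> b), a e False) \<in> conn a X"
    using conn_insertD[OF assms(1)] assms(2) by auto
  have m: "conn a X \<subseteq> conn a (insert e X)" by (rule conn_mono) auto
  have "(a f b, a e True) \<in> conn a (insert e X)" using conn_sym[OF b(1)] m by blast
  moreover have "(a e True, a e False) \<in> conn a (insert e X)" using conn_edge[of e "insert e X" a True] by simp
  moreover have "(a e False, a f (\<not> b)) \<in> conn a (insert e X)" using conn_sym[OF b(2)] m by blast
  ultimately have "(a f b, a f (\<not> b)) \<in> conn a (insert e X)" by (meson rtrancl_trans)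
  then show ?thesis using conn_sym[of "a f False" "a f True" a "insert e X"] by (cases b) auto
qed

lemma forest_subset: "forest a X \<Longrightarrow> Y \<subseteq> X \<Longrightarrow> forest a Y"
  unfolding forest_def by (meson Diff_mono conn_mono order_refl subsetD)

lemma forest_insert:
  assumes "forest a X" "\<not> spans a X e"
  shows "forest a (insert e X)"
  unfolding forest_def
proof
  fix f assume f: "f \<in> insert e X"
  have eX: "e \<notin> X" using assms(2) conn_edge[of e X a True] by auto
  show "\<not> spans a (insert e X - {f}) f"
  proof (cases "f = e")
    case True
    then show ?thesis using assms(2) eX by simp
  next
    case False
    then have fX: "f \<in> X" using f by simp
    have *: "insert e X - {f} = insert e (X - {f})" "insert f (X - {f}) = X" using False fX by auto
    show ?thesis
      using spans_exchange[of a f e "X - {f}"] assms fX unfolding * forest_def by blast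
  qed
qed

lemma forest_exchange:
  assumes "forest a X" "D \<subseteq> X" "spans a D e" "\<And>D'. D' \<subset> D \<Longrightarrow> \<not> spans a D' e" "f \<in> D"
  shows "forest a (insert e (X - {f}))" "spans a (insert e (D - {f})) f"
proof -
  have "D = insert f (D - {f})" using assms(5) by auto
  moreover have "\<not> spans a (D - {f}) e" using assms(4)[of "D - {f}"] assms(5) by auto
  ultimately show *: "spans a (insert e (D - {f})) f"
    using spans_exchange[of a e f "D - {f}"] assms(3) by simp
  have "\<not> spans a (X - {f}) e"
  proof
    assume e: "spans a (X - {f}) e"
    have "conn a (insert e (D - {f})) \<subseteq> conn a (X - {f})"
    proof (rule conn_subset)
      fix g assume "g \<in> insert e (D - {f})"
      then show "spans a (X - {f}) g"
        using e assms(2) conn_edge[of g "X - {f}" a True] by (cases "g = e") auto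
    qed
    from subsetD[OF this *] show False using assms(1,2,5) by (auto simp: forest_def)
  qed
  moreover have "forest a (X - {f})" by (rule forest_subset[OF assms(1)]) auto
  ultimately show "forest a (insert e (X - {f}))" by (rule forest_insert[rotated])
qed

text \<open>
  Every edge that is added to a forest merges two of its components.
\<close>

lemma card_forest_less:
  assumes "finite V" "V \<noteq> {}" "finite X" "\<And>e b. e \<in> X \<Longrightarrow> a e b \<in> V" "forest a X"
  shows "card X < card V"
proof -
  define comps where "comps X = (\<lambda>v. conn a X `` {v}) ` V" for X
  have "card X + card (comps X) \<le> card V"
    using assms(3,4,5)
  proof (induction X rule: finite_induct)
    case empty
    show ?case using assms(1) by (simp add: comps_def card_image_le)
  next
    case (insert e X)
    have IH: "card X + card (comps X) \<le> card V"
      using insert.IH insert.prems forest_subset[of a "insert e X" X] by blast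
    have ne: "\<not> spans a X e" using insert.prems(2) insert.hyps(2) unfolding forest_def by auto
    define g where "g C = conn a (insert e X) `` C" for C
    have m: "conn a X \<subseteq> conn a (insert e X)" by (rule conn_mono) auto
    have g: "g (conn a X `` {v}) = conn a (insert e X) `` {v}" for v
      using m unfolding g_def by (blast intro: rtrancl_trans)
    have im: "comps (insert e X) = g ` comps X" unfolding comps_def image_image g ..
    have "\<not> inj_on g (comps X)"
    proof
      assume inj: "inj_on g (comps X)"
      have "conn a (insert e X) `` {a e True} = conn a (insert e X) `` {a e False}"
        using conn_edge[of e "insert e X" a True] conn_edge[of e "insert e X" a False]
        by (auto intro: rtrancl_trans)
      then have "conn a X `` {a e True} = conn a X `` {a e False}"
        unfolding g[symmetric]
        by (rule inj_onD[OF inj]) (use insert.prems(1)[of e] in \<open>auto simp: comps_def\<close>)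
      then show False using ne by auto
    qed
    moreover have "finite (comps X)" using assms(1) by (simp add: comps_def)
    ultimately have "card (comps (insert e X)) < card (comps X)"
      unfolding im by (metis card_image_le eq_card_imp_inj_on nat_less_le)
    then show ?case using IH insert.hyps by simp
  qed
  moreover have "0 < card (comps X)" using assms(1,2) by (simp add: comps_def card_gt_0_iff)
  ultimately show ?thesis by simp
qed

text \<open>
  A counting relative of the theorem of Nash-Williams and Tutte on packing spanning trees.

  Take \<open>q\<close> disjoint forests with as many edges as possible in total. By their number, some edge is not
  used. An unused edge closes a circuit in each of the forests, and may be exchanged for any other edge
  of this circuit. Let \<open>S\<close> be the set of all edges that are unused after some sequence of exchanges. An
  exchange takes place inside \<open>S\<close>, along a circuit contained in \<open>S\<close>, so that the components of each
  forest restricted to \<open>S\<close> never change. Hence every edge of \<open>S\<close> is spanned by the edges of \<open>S\<close> in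
  each of the original forests, and \<open>U\<close> can be any component of the graph with edge set \<open>S\<close>.
\<close>

lemma dense_spanning_packing:
  fixes a :: "'e \<Rightarrow> bool \<Rightarrow> 'v"
  assumes "finite E" "finite V" "V \<noteq> {}" "\<And>e b. e \<in> E \<Longrightarrow> a e b \<in> V"
    and loopless: "\<And>e. e \<in> E \<Longrightarrow> a e True \<noteq> a e False"
    and dense: "q * (card V - 1) < card E"
  obtains U F where "U \<subseteq> V" "2 \<le> card U" "\<And>i. i < q \<Longrightarrow> F i \<subseteq> {e \<in> E. \<forall>b. a e b \<in> U}"
    "\<And>i j. i < q \<Longrightarrow> j < q \<Longrightarrow> i \<noteq> j \<Longrightarrow> F i \<inter> F j = {}"
    "\<And>i x y. i < q \<Longrightarrow> x \<in> U \<Longrightarrow> y \<in> U \<Longrightarrow> (x, y) \<in> conn a (F i)"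
proof -
  define valid where "valid F \<longleftrightarrow> (\<forall>i<q. F i \<subseteq> E \<and> forest a (F i)) \<and>
      (\<forall>i<q. \<forall>j<q. i \<noteq> j \<longrightarrow> F i \<inter> F j = {})" for F :: "nat \<Rightarrow> 'e set"
  define total where "total F = (\<Sum>i<q. card (F i))" for F :: "nat \<Rightarrow> 'e set"
  define used where "used F = (\<Union>i<q. F i)" for F :: "nat \<Rightarrow> 'e set"
  have fin: "finite (F i)" if "valid F" "i < q" for F i
    by (rule finite_subset[OF _ assms(1)]) (use that in \<open>simp add: valid_def\<close>)
  have valid_forest: "forest a (F i)" and valid_sub: "F i \<subseteq> E" if "valid F" "i < q" for F i
    using that by (auto simp: valid_def)
  have total_upd: "total (F(i := Y)) + card (F i) = total F + card Y" if "i < q" for F i Y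
  proof -
    have "total G = card (G i) + (\<Sum>j\<in>{..<q} - {i}. card (G j))" for G
      unfolding total_def using that by (simp add: sum.remove)
    from this[of F] this[of "F(i := Y)"] show ?thesis by simp
  qed
  have valid_upd: "valid (F(i := Y))" 
    if "valid F" "i < q" "Y \<subseteq> E" "forest a Y" "Y \<inter> used F \<subseteq> F i" for F i Y
    unfolding valid_def
  proof (intro conjI allI impI)
    have "Y \<inter> F j = {}" if "j < q" "j \<noteq> i" for j
      using that \<open>valid F\<close> \<open>i < q\<close> \<open>Y \<inter> used F \<subseteq> F i\<close> unfolding valid_def used_def by blast
    then show "(F(i := Y)) j \<inter> (F(i := Y)) l = {}" if "j < q" "l < q" "j \<noteq> l" for j l
      using that \<open>valid F\<close> unfolding valid_def by (auto simp: Int_commute)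
  qed (use that in \<open>auto simp: valid_def\<close>)
  have "valid (\<lambda>_. {})" by (simp add: valid_def forest_def)
  moreover have "\<forall>F. valid F \<longrightarrow> total F < Suc (q * card E)"
  proof (intro allI impI)
    fix F assume F: "valid F"
    have "total F \<le> (\<Sum>i<q. card E)"
      unfolding total_def by (rule sum_mono) (use F assms(1) in \<open>auto simp: valid_def intro: card_mono\<close>)
    then show "total F < Suc (q * card E)" by simp
  qed
  ultimately obtain F0 where F0: "valid F0" "\<And>F. valid F \<Longrightarrow> total F \<le> total F0"
    using ex_has_greatest_nat[of valid _ total] by blast
  define good where "good F \<longleftrightarrow> valid F \<and> total F = total F0" for F
  have spanned: "spans a (F i) e" if "good F" "i < q" "e \<in> E" "e \<notin> used F" for F i e
  proof (rule ccontr)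
    assume "\<not> spans a (F i) e"
    moreover have vF: "valid F" using that(1) by (simp add: good_def)
    ultimately have f: "forest a (insert e (F i))" by (intro forest_insert valid_forest that(2))
    have "valid (F(i := insert e (F i)))"
      by (rule valid_upd[OF vF that(2) _ f]) (use that valid_sub[OF vF that(2)] in auto)
    moreover have "e \<notin> F i" using that by (auto simp: used_def)
    then have "total (F(i := insert e (F i))) = Suc (total F)"
      using total_upd[OF that(2), of F "insert e (F i)"] fin[of F i] that by (simp add: good_def)
    ultimately show False using F0(2)[of "F(i := insert e (F i))"] that(1) by (simp add: good_def)
  qed
  define circuit where "circuit F i e D \<longleftrightarrow> D \<subseteq> F i \<and> spans a D e \<and> (\<forall>D'. D' \<subset> D \<longrightarrow> \<not> spans a D' e)"
    for F :: "nat \<Rightarrow> 'e set" and i e D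
  have circuit_ex: "\<exists>D. circuit F i e D" if "good F" "i < q" "e \<in> E" "e \<notin> used F" for F i e
  proof -
    have "\<exists>D. (D \<subseteq> F i \<and> spans a D e) \<and> (\<forall>D'. D' \<subseteq> F i \<and> spans a D' e \<longrightarrow> card D \<le> card D')"
      by (rule ex_has_least_nat) (use spanned[OF that] in auto)
    then obtain D where D: "D \<subseteq> F i" "spans a D e" "\<And>D'. D' \<subseteq> F i \<Longrightarrow> spans a D' e \<Longrightarrow> card D \<le> card D'"
      by blast
    have "finite D" using D(1) fin[of F i] that finite_subset by (auto simp: good_def)
    then have "\<not> spans a D' e" if "D' \<subset> D" for D'
      using D(1) D(3)[of D'] that psubset_card_mono[of D D'] by fastforce
    then show ?thesis using D by (auto simp: circuit_def)
  qed
  \<comment> \<open>One exchange: the unused edge \<open>e\<close> replaces the edge \<open>f\<close> of its circuit in the forest \<open>F i\<close>.\<close>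
  define step where "step F F' \<longleftrightarrow> (\<exists>i e D f. i < q \<and> e \<in> E \<and> e \<notin> used F \<and> circuit F i e D \<and> f \<in> D \<and>
      F' = F(i := insert e (F i - {f})))" for F F'
  have step_good: "good (F(i := insert e (F i - {f})))" "f \<in> E" "f \<notin> used (F(i := insert e (F i - {f})))"
      "spans a (insert e (D - {f})) f"
    if "good F" "i < q" "e \<in> E" "e \<notin> used F" "circuit F i e D" "f \<in> D" for F i e D f
  proof -
    have vF: "valid F" using that(1) by (simp add: good_def)
    have D: "D \<subseteq> F i" "spans a D e" "\<And>D'. D' \<subset> D \<Longrightarrow> \<not> spans a D' e"
      using that(5) by (auto simp: circuit_def)
    note ex = forest_exchange[OF valid_forest[OF vF that(2)] D that(6)]
    show "spans a (insert e (D - {f})) f" by (rule ex(2))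
    have fF: "f \<in> F i" using D(1) that(6) by auto
    then show fE: "f \<in> E" using valid_sub[OF vF that(2)] by auto
    have ef: "e \<noteq> f" using fF that by (auto simp: used_def)
    have "f \<notin> F j" if "j < q" "j \<noteq> i" for j
      using fF that vF \<open>i < q\<close> unfolding valid_def by blast
    then show "f \<notin> used (F(i := insert e (F i - {f})))" using ef by (auto simp: used_def)
    have "valid (F(i := insert e (F i - {f})))"
      by (rule valid_upd[OF vF that(2) _ ex(1)]) (use that(3,4) valid_sub[OF vF that(2)] in auto)
    moreover have "card (insert e (F i - {f})) = card (F i)"
    proof -
      have "e \<notin> F i - {f}" "finite (F i)" using that fin[of F i] by (auto simp: used_def good_def)
      then show ?thesis using fF card.remove[of "F i" f] by simp
    qed
    ultimately show "good (F(i := insert e (F i - {f})))"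
      using total_upd[OF that(2), of F "insert e (F i - {f})"] that(1) by (simp add: good_def)
  qed
  have reach_good: "good F" if "step\<^sup>*\<^sup>* F0 F" for F
    using that
  proof (induction rule: rtranclp_induct)
    case base
    then show ?case using F0 by (simp add: good_def)
  next
    case (step F F')
    then show ?case using step_good(1) unfolding step_def by blast
  qed
  define S where "S = {e \<in> E. \<exists>F. step\<^sup>*\<^sup>* F0 F \<and> e \<notin> used F}"
  have circuit_S: "D \<subseteq> S" if "step\<^sup>*\<^sup>* F0 F" "i < q" "e \<in> E" "e \<notin> used F" "circuit F i e D" for F i e D
  proof
    fix f assume f: "f \<in> D"
    have "step F (F(i := insert e (F i - {f})))" unfolding step_def using that f by blast
    then have "step\<^sup>*\<^sup>* F0 (F(i := insert e (F i - {f})))" using that(1) by simp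
    then show "f \<in> S" using step_good(2,3)[OF reach_good[OF that(1)] that(2-5) f] unfolding S_def by blast
  qed
  have inv: "conn a (F j \<inter> S) = conn a (F0 j \<inter> S)" if "step\<^sup>*\<^sup>* F0 F" "j < q" for F j
    using that(1)
  proof (induction rule: rtranclp_induct)
    case base
    show ?case ..
  next
    case (step F F')
    then obtain i e D f where st: "i < q" "e \<in> E" "e \<notin> used F" "circuit F i e D" "f \<in> D"
      and F': "F' = F(i := insert e (F i - {f}))" unfolding step_def by blast
    show ?case
    proof (cases "j = i")
      case False
      then show ?thesis using F' step.IH by simp
    next
      case True
      have DS: "D \<subseteq> F i \<inter> S" using circuit_S[OF step.hyps(1) st(1-4)] st(4) by (auto simp: circuit_def)
      have eS: "e \<in> S" using st step.hyps(1) by (auto simp: S_def)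
      have eq: "F' j \<inter> S = insert e (F i \<inter> S - {f})" using F' True eS by auto
      have De: "insert e (D - {f}) \<subseteq> insert e (F i \<inter> S - {f})" using DS by auto
      have "conn a (F' j \<inter> S) \<subseteq> conn a (F i \<inter> S)" unfolding eq
      proof (rule conn_subset)
        fix g assume "g \<in> insert e (F i \<inter> S - {f})"
        then show "spans a (F i \<inter> S) g"
          using st(4) conn_mono[OF DS, of a] conn_edge[of g "F i \<inter> S" a True] by (auto simp: circuit_def)
      qed
      moreover have "conn a (F i \<inter> S) \<subseteq> conn a (F' j \<inter> S)" unfolding eq
      proof (rule conn_subset)
        fix g assume g: "g \<in> F i \<inter> S"
        show "spans a (insert e (F i \<inter> S - {f})) g"
        proof (cases "g = f")
          case True
          then show ?thesis
            using step_good(4)[OF reach_good[OF step.hyps(1)] st] conn_mono[OF De, of a] by blast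
        next
          case False
          then show ?thesis using g conn_edge[of g "insert e (F i \<inter> S - {f})" a True] by auto
        qed
      qed
      ultimately show ?thesis using step.IH True by simp
    qed
  qed
  have S_span: "spans a (F0 i \<inter> S) e" if e: "e \<in> S" and i: "i < q" for e i
  proof -
    obtain F where F: "step\<^sup>*\<^sup>* F0 F" "e \<in> E" "e \<notin> used F" using e by (auto simp: S_def)
    obtain D where D: "circuit F i e D" using circuit_ex[OF reach_good[OF F(1)] i F(2,3)] by blast
    have "D \<subseteq> F i \<inter> S" using circuit_S[OF F(1) i F(2,3) D] D by (auto simp: circuit_def)
    then have "conn a D \<subseteq> conn a (F i \<inter> S)" by (rule conn_mono)
    then show ?thesis using D inv[OF F(1) i] by (auto simp: circuit_def)
  qed
  have "card (used F0) \<le> q * (card V - 1)"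
  proof -
    have "card (used F0) \<le> (\<Sum>i<q. card (F0 i))" unfolding used_def by (rule card_UN_le) simp
    also have "\<dots> \<le> (\<Sum>i<q. card V - 1)"
    proof (rule sum_mono)
      fix i assume i: "i \<in> {..<q}"
      have "card (F0 i) < card V"
        by (rule card_forest_less[OF assms(2,3)]) (use F0(1) i fin[of F0 i] assms(4) in \<open>auto simp: valid_def\<close>)
      then show "card (F0 i) \<le> card V - 1" by simp
    qed
    finally show ?thesis by simp
  qed
  with dense have "\<not> E \<subseteq> used F0"
    using card_mono[of "used F0" E] fin[OF F0(1)] by (auto simp: used_def)
  then obtain e0 where e0: "e0 \<in> E" "e0 \<notin> used F0" by auto
  then have e0S: "e0 \<in> S" by (auto simp: S_def)
  define U where "U = conn a S `` {a e0 True}"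
  have UV: "U \<subseteq> V"
  proof
    fix x assume "x \<in> U"
    then have "(a e0 True, x) \<in> conn a S" by (simp add: U_def)
    then show "x \<in> V" using e0(1) assms(4)
      by (induction rule: rtrancl_induct) (auto simp: adj_def S_def)
  qed
  have "{a e0 True, a e0 False} \<subseteq> U" using conn_edge[OF e0S, of a True] by (auto simp: U_def)
  then have "card {a e0 True, a e0 False} \<le> card U" using UV assms(2) by (meson card_mono finite_subset)
  then have cU: "2 \<le> card U" using loopless[OF e0(1)] by simp
  define F where "F i = {e \<in> F0 i \<inter> S. \<forall>b. a e b \<in> U}" for i
  have closed: "a e (\<not> b) \<in> U" if "e \<in> S" "a e b \<in> U" for e b
    using that conn_edge[OF that(1), of a b] unfolding U_def by (auto intro: rtrancl_trans)
  have conn: "(x, y) \<in> conn a (F i)" if i: "i < q" and x: "x \<in> U" and y: "y \<in> U" for i x y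
  proof -
    have "(x, a e0 True) \<in> conn a S" "(a e0 True, y) \<in> conn a S" using x y conn_sym[of "a e0 True" x a S] by (auto simp: U_def)
    then have "(x, y) \<in> conn a S" by (rule rtrancl_trans)
    moreover have "conn a S \<subseteq> conn a (F0 i \<inter> S)" by (rule conn_subset) (rule S_span[OF _ i])
    ultimately have "(x, y) \<in> conn a (F0 i \<inter> S)" by blast
    then have "(x, y) \<in> conn a (F i) \<and> y \<in> U"
    proof (induction rule: rtrancl_induct)
      case base
      then show ?case using x by simp
    next
      case (step y z)
      then obtain e b where e: "e \<in> F0 i \<inter> S" "y = a e b" "z = a e (\<not> b)" by (auto simp: adj_def)
      have z: "z \<in> U" using closed[of e b] e step.IH by auto
      have "e \<in> F i" unfolding F_def using e z step.IH by (cases b) (auto simp: all_bool_eq)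
      then have "(y, z) \<in> conn a (F i)" using conn_edge[of e "F i" a b] e by simp
      then show ?case using step.IH z by (auto intro: rtrancl_trans)
    qed
    then show ?thesis ..
  qed
  show ?thesis
  proof (rule that[OF UV cU])
    show "F i \<subseteq> {e \<in> E. \<forall>b. a e b \<in> U}" if "i < q" for i by (auto simp: F_def S_def)
    show "F i \<inter> F j = {}" if "i < q" "j < q" "i \<noteq> j" for i j
      using F0(1) that unfolding valid_def F_def by blast
  qed (rule conn)
qed

section \<open>Cuts and parity\<close>

definition cut_card :: "'e set \<Rightarrow> ('e \<Rightarrow> bool \<Rightarrow> 'v) \<Rightarrow> 'v set \<Rightarrow> int" where
  "cut_card E a X = (\<Sum>e\<in>E. of_bool ((a e True \<in> X) \<noteq> (a e False \<in> X)))"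

lemma sum_dg:
  assumes "finite X"
  shows "(\<Sum>v\<in>X. dg E a v) = (\<Sum>e\<in>E. of_bool (a e True \<in> X) + of_bool (a e False \<in> X))"
proof -
  have "(\<Sum>v\<in>X. dg E a v) = (\<Sum>e\<in>E. \<Sum>v\<in>X. (if a e True = v then 1 else 0) + (if a e False = v then 1 else 0))"
    unfolding wdeg_def by (rule sum.swap)
  also have "\<dots> = (\<Sum>e\<in>E. of_bool (a e True \<in> X) + of_bool (a e False \<in> X))"
    using assms by (intro sum.cong) (simp_all add: sum.distrib)
  finally show ?thesis .
qed

text \<open>
  An edge with both ends in \<open>X\<close> contributes 2 to the sum of the degrees, a crossing edge 1.
\<close>

lemma sum_dg_cut:
  assumes "finite X"
  shows "even ((\<Sum>v\<in>X. dg E a v) - cut_card E a X)"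
  unfolding sum_dg[OF assms] cut_card_def sum_subtractf[symmetric] by (rule dvd_sum) auto

lemma sum_dg_inside:
  assumes "finite X" "\<And>e b. e \<in> E \<Longrightarrow> a e b \<in> X"
  shows "(\<Sum>v\<in>X. dg E a v) = 2 * int (card E)"
  unfolding sum_dg[OF assms(1)] using assms(2) by simp

lemma cut_compl:
  assumes "\<And>e b. e \<in> E \<Longrightarrow> a e b \<in> V"
  shows "cut_card E a (V - X) = cut_card E a X"
  unfolding cut_card_def by (rule sum.cong) (use assms in auto)

lemma cut_Int_Un: "cut_card E a (X \<inter> Y) + cut_card E a (X \<union> Y) \<le> cut_card E a X + cut_card E a Y"
  unfolding cut_card_def sum.distrib[symmetric] by (rule sum_mono) auto

lemma cut_Diff_Diff:
  assumes "finite E" "e \<in> E" "a e b \<in> X \<inter> Y" "a e (\<not> b) \<notin> X \<union> Y"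
  shows "cut_card E a (X - Y) + cut_card E a (Y - X) + 2 \<le> cut_card E a X + cut_card E a Y"
proof -
  have "cut_card E a (X - Y) + cut_card E a (Y - X) + 2 = (\<Sum>e'\<in>E. of_bool ((a e' True \<in> X - Y) \<noteq> (a e' False \<in> X - Y)) +
     of_bool ((a e' True \<in> Y - X) \<noteq> (a e' False \<in> Y - X)) + (if e' = e then 2 else 0))"
    unfolding cut_card_def sum.distrib using assms(1,2) by simp
  also have "\<dots> \<le> cut_card E a X + cut_card E a Y"
    unfolding cut_card_def sum.distrib[symmetric] using assms(3,4) by (intro sum_mono) (cases b; auto)
  finally show ?thesis .
qed

lemma cut_remove:
  assumes "finite E" "e \<in> E"
  shows "cut_card E a X = of_bool ((a e True \<in> X) \<noteq> (a e False \<in> X)) + cut_card (E - {e}) a X"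
  unfolding cut_card_def by (rule sum.remove[OF assms])

lemma cut_merge:
  assumes "finite E" "e \<in> E" "e' \<in> E" "e \<noteq> e'" "a e b = u" "a e' b' = u"
  shows "cut_card E a X = cut_card (E - {e'}) (merge a e b e' b') X +
     (if (u \<in> X) \<noteq> (a e (\<not> b) \<in> X) \<and> (u \<in> X) \<noteq> (a e' (\<not> b') \<in> X) then 2 else 0)"
proof -
  have r: "cut_card E f X = of_bool ((f e' True \<in> X) \<noteq> (f e' False \<in> X)) + cut_card (E - {e'}) f X"
    "cut_card (E - {e'}) f X = of_bool ((f e True \<in> X) \<noteq> (f e False \<in> X)) + cut_card (E - {e'} - {e}) f X" for f
    using cut_remove[of E e' f X] cut_remove[of "E - {e'}" e f X] assms(1-4) by auto
  have s: "cut_card (E - {e'} - {e}) (merge a e b e' b') X = cut_card (E - {e'} - {e}) a X"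
    unfolding cut_card_def by (rule sum.cong) (auto simp: merge_def)
  show ?thesis
    unfolding r(1)[of a] r(2) s using assms(4-6) by (cases b; cases b') (auto simp: merge_def)
qed

lemma cut_cong:
  assumes "\<And>e b. e \<in> E \<Longrightarrow> a e b \<in> X \<longleftrightarrow> a' e b \<in> X'"
  shows "cut_card E a X = cut_card E a' X'"
  unfolding cut_card_def by (rule sum.cong) (use assms in auto)

lemma even_sum_dg:
  assumes "finite X" "X \<subseteq> V" "\<And>v. v \<in> V \<Longrightarrow> even (dg E a v) \<longleftrightarrow> even k \<or> v \<notin> T"
  shows "even (\<Sum>v\<in>X. dg E a v) \<longleftrightarrow> even k \<or> even (card (X \<inter> T))"
proof -
  have "{v \<in> X. odd (dg E a v)} = (if even k then {} else X \<inter> T)" using assms(2,3) by auto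
  then show ?thesis unfolding even_sum_iff[OF assms(1)] by auto
qed

section \<open>Lifting a pair of edges at an even vertex\<close>

text \<open>
  Lifting a pair of edges at \<open>v\<close> decreases by 2 the cuts that separate \<open>v\<close> from the two other ends, and
  by the parity of the cuts this does harm only for tight sets, those with cut exactly \<open>l\<close>. Fix an
  edge from \<open>v\<close> to \<open>y\<close>. If there is a tight set that contains \<open>y\<close> but not \<open>v\<close>, let \<open>A\<close> be a largest
  one. Not all edges at \<open>v\<close> lead into \<open>A\<close>, since otherwise adding \<open>v\<close> to \<open>A\<close> would give a smaller
  cut. So the second edge can be chosen to lead to some \<open>z\<close> outside \<open>A\<close>. A tight set \<open>X\<close> with both \<open>y\<close> and
  \<open>z\<close> would be uncrossed with \<open>A\<close>: either the union is tight and larger than \<open>A\<close>, or the two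
  differences are tight and no edge joins the intersection to the outside, contrary to the edge
  between \<open>y\<close> and \<open>v\<close>.
\<close>

lemma liftable_pair:
  fixes a :: "'e \<Rightarrow> bool \<Rightarrow> 'v" and k :: nat and l :: int
  assumes fin: "finite E" "finite V" and ends: "\<And>e b. e \<in> E \<Longrightarrow> a e b \<in> V" and TV: "T \<subseteq> V"
    and par: "\<And>v. v \<in> V \<Longrightarrow> even (dg E a v) \<longleftrightarrow> even k \<or> v \<notin> T"
    and l: "even (l + int k)" "0 < l"
    and con: "\<And>X. X \<subseteq> V \<Longrightarrow> odd (card (X \<inter> T)) \<Longrightarrow> l \<le> cut_card E a X"
    and loopless: "\<And>e. e \<in> E \<Longrightarrow> a e True \<noteq> a e False"
    and v: "v \<in> V" "v \<notin> T" "e \<in> E" "a e b = v"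
  shows "\<exists>e' b'. e' \<in> E \<and> e' \<noteq> e \<and> a e' b' = v \<and>
    (\<forall>X. X \<subseteq> V \<longrightarrow> odd (card (X \<inter> T)) \<longrightarrow> l \<le> cut_card (E - {e'}) (merge a e b e' b') X)"
proof -
  define y where "y = a e (\<not> b)"
  have yv: "y \<noteq> v" using loopless[OF v(3)] v(4) by (cases b) (auto simp: y_def)
  have finX: "finite X" if "X \<subseteq> V" for X using that fin finite_subset by auto
  have finT: "finite (X \<inter> T)" for X using TV finX by auto
  have cut_par: "even (cut_card E a X) \<longleftrightarrow> even k \<or> even (card (X \<inter> T))" if "X \<subseteq> V" for X
    using sum_dg_cut[OF finX[OF that], of E a] even_sum_dg[OF finX[OF that] that par] by simp
  have "even (card T)"
  proof (rule ccontr)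
    assume "odd (card T)"
    then have "l \<le> cut_card E a V" using con[of V] TV by (simp add: Int_absorb1)
    moreover have "cut_card E a V = 0" unfolding cut_card_def using ends by simp
    ultimately show False using l(2) by simp
  qed
  moreover have "card T = card (X \<inter> T) + card ((V - X) \<inter> T)" if "X \<subseteq> V" for X
  proof -
    have "T = X \<inter> T \<union> (V - X) \<inter> T" using TV that by auto
    then show ?thesis using card_Un_disjoint[OF finT finT, of X "V - X"] by fastforce
  qed
  ultimately have odd_compl: "odd (card ((V - X) \<inter> T))" if "X \<subseteq> V" "odd (card (X \<inter> T))" for X
    using that by (metis even_add)
  define tight where "tight A \<longleftrightarrow> A \<subseteq> V - {v} \<and> odd (card (A \<inter> T)) \<and> cut_card E a A = l \<and> y \<in> A" for A
  have "\<exists>e' b'. e' \<in> E \<and> e' \<noteq> e \<and> a e' b' = v \<and> (\<forall>X. tight X \<longrightarrow> a e' (\<not> b') \<notin> X)"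
  proof (cases "\<exists>A. tight A")
    case False
    have "dg E a v = 1 + dg (E - {e}) a v"
      using v(4) loopless[OF v(3)] by (cases b) (auto simp: wdeg_remove[OF fin(1) v(3)])
    moreover have "even (dg E a v)" using par v by simp
    ultimately have "dg (E - {e}) a v \<noteq> 0" by auto
    then show ?thesis using dg_touched[of "E - {e}" a v] False by auto
  next
    case True
    have "\<forall>A. tight A \<longrightarrow> card A < Suc (card V)"
      unfolding tight_def using fin(2) by (metis Diff_subset card_mono le_imp_less_Suc subset_trans)
    then obtain A where A: "tight A" and max: "\<And>B. tight B \<Longrightarrow> card B \<le> card A"
      using True ex_has_greatest_nat[of tight _ card] by blast
    note A' = A[unfolded tight_def]
    have "\<exists>e'\<in>E. \<exists>b'. a e' b' = v \<and> a e' (\<not> b') \<notin> A"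
    proof (rule ccontr)
      assume no: "\<not> (\<exists>e'\<in>E. \<exists>b'. a e' b' = v \<and> a e' (\<not> b') \<notin> A)"
      have "cut_card E a (insert v A) < cut_card E a A"
        unfolding cut_card_def
      proof (rule sum_strict_mono_ex1[OF fin(1)])
        show "\<forall>e\<in>E. of_bool ((a e True \<in> insert v A) \<noteq> (a e False \<in> insert v A))
            \<le> (of_bool ((a e True \<in> A) \<noteq> (a e False \<in> A)) :: int)"
        proof
          fix e' assume "e' \<in> E"
          then have "a e' True = v \<Longrightarrow> a e' False \<in> A" "a e' False = v \<Longrightarrow> a e' True \<in> A"
            using no by (metis (full_types))+
          then show "of_bool ((a e' True \<in> insert v A) \<noteq> (a e' False \<in> insert v A))
            \<le> (of_bool ((a e' True \<in> A) \<noteq> (a e' False \<in> A)) :: int)" using A' by auto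
        qed
        show "\<exists>e\<in>E. of_bool ((a e True \<in> insert v A) \<noteq> (a e False \<in> insert v A))
            < (of_bool ((a e True \<in> A) \<noteq> (a e False \<in> A)) :: int)"
          using v(3,4) A' by (intro bexI[of _ e]) (cases b; auto simp: y_def)+
      qed
      moreover have "insert v A \<inter> T = A \<inter> T" using v(2) by auto
      ultimately show False using con[of "insert v A"] A' v(1) by auto
    qed
    then obtain e' b' where e': "e' \<in> E" "a e' b' = v" "a e' (\<not> b') \<notin> A" by blast
    have ne: "e' \<noteq> e"
    proof
      assume "e' = e"
      then have "b' \<noteq> b" using e'(3) A' by (auto simp: y_def)
      then show False using e'(2) \<open>e' = e\<close> v(4) loopless[OF v(3)] by (cases b; cases b') auto
    qed
    have "a e' (\<not> b') \<notin> X" if X: "tight X" for X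
    proof
      assume z: "a e' (\<not> b') \<in> X"
      note X' = X[unfolded tight_def]
      have sub: "A \<union> X \<subseteq> V" "A \<inter> X \<subseteq> V" "A - X \<subseteq> V" "X - A \<subseteq> V" using A' X' by auto
      have "card (A \<inter> T) + card (X \<inter> T) = card ((A \<union> X) \<inter> T) + card (A \<inter> X \<inter> T)"
      proof -
        have "(A \<union> X) \<inter> T = A \<inter> T \<union> X \<inter> T" "A \<inter> X \<inter> T = (A \<inter> T) \<inter> (X \<inter> T)" by auto
        then show ?thesis using card_Un_Int[OF finT finT, of A X] by simp
      qed
      then have p1: "even (card ((A \<union> X) \<inter> T)) \<longleftrightarrow> even (card (A \<inter> X \<inter> T))"
        using A' X' by (metis even_add)
      have dif: "card (Y \<inter> T) = card ((Y - Z) \<inter> T) + card (Y \<inter> Z \<inter> T)" for Y Z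
      proof -
        have "Y \<inter> T = (Y - Z) \<inter> T \<union> Y \<inter> Z \<inter> T" "(Y - Z) \<inter> T \<inter> (Y \<inter> Z \<inter> T) = {}" by auto
        then show ?thesis using card_Un_disjoint[OF finT finT, of "Y - Z" "Y \<inter> Z"] by simp
      qed
      show False
      proof (cases "odd (card (A \<inter> X \<inter> T))")
        case True
        have "l \<le> cut_card E a (A \<inter> X)" "l \<le> cut_card E a (A \<union> X)" using con sub True p1 by auto
        then have "cut_card E a (A \<union> X) = l" using cut_Int_Un[of E a A X] A' X' by linarith
        then have "tight (A \<union> X)" using A' X' True p1 by (auto simp: tight_def)
        then have "card (A \<union> X) \<le> card A" by (rule max)
        then have "A \<union> X = A" using card_subset_eq[of "A \<union> X" A] finX[OF sub(1)]
          by (metis Un_upper1 card_mono le_antisym)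
        then show False using z e'(3) by auto
      next
        case False
        have "odd (card ((A - X) \<inter> T))" "odd (card ((X - A) \<inter> T))"
          using dif[of A X] dif[of X A] False A' X' by (simp_all add: Int_commute[of X A])
        then have "l \<le> cut_card E a (A - X)" "l \<le> cut_card E a (X - A)" using con sub by auto
        moreover have "cut_card E a (A - X) + cut_card E a (X - A) + 2 \<le> cut_card E a A + cut_card E a X"
          by (rule cut_Diff_Diff[OF fin(1) v(3), of a "\<not> b"]) (use A' X' v(4) in \<open>auto simp: y_def\<close>)
        ultimately show False using A' X' by linarith
      qed
    qed
    then show ?thesis using e' ne by blast
  qed
  then obtain e' b' where e': "e' \<in> E" "e' \<noteq> e" "a e' b' = v" and nt: "\<And>X. tight X \<Longrightarrow> a e' (\<not> b') \<notin> X"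
    by blast
  have "l \<le> cut_card (E - {e'}) (merge a e b e' b') X" if X: "X \<subseteq> V" "odd (card (X \<inter> T))" for X
  proof -
    have mc: "cut_card E a X = cut_card (E - {e'}) (merge a e b e' b') X +
      (if (v \<in> X) \<noteq> (y \<in> X) \<and> (v \<in> X) \<noteq> (a e' (\<not> b') \<in> X) then 2 else 0)"
      unfolding y_def by (rule cut_merge) (use fin v e' in auto)
    show ?thesis
    proof (cases "(v \<in> X) \<noteq> (y \<in> X) \<and> (v \<in> X) \<noteq> (a e' (\<not> b') \<in> X)")
      case False
      then show ?thesis using mc[unfolded if_not_P[OF False]] con[OF X] by simp
    next
      case True
      define Z where "Z = (if v \<in> X then V - X else X)"
      have Z: "Z \<subseteq> V - {v}" "odd (card (Z \<inter> T))" "cut_card E a Z = cut_card E a X"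
        using X odd_compl[OF X] cut_compl[OF ends] by (auto simp: Z_def)
      have "y \<in> Z" "a e' (\<not> b') \<in> Z" using True ends[OF v(3)] ends[OF e'(1)] by (auto simp: Z_def y_def)
      then have "cut_card E a Z \<noteq> l" using nt[of Z] Z by (auto simp: tight_def)
      moreover have "l \<le> cut_card E a Z" using Z(1,2) by (intro con) auto
      moreover have "even (cut_card E a Z) \<longleftrightarrow> even l" using cut_par[of Z] Z l(1) by auto
      ultimately have "l + 2 \<le> cut_card E a Z" by presburger
      then show ?thesis using mc[unfolded if_P[OF True]] Z(3) by simp
    qed
  qed
  then show ?thesis using e' by blast
qed

section \<open>Joins\<close>

lemma even_dg_sym_diff:
  assumes "finite A" "finite B"
  shows "even (dg (sym_diff A B) a v) \<longleftrightarrow> (even (dg A a v) \<longleftrightarrow> even (dg B a v))"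
proof -
  have "sym_diff A B = (A - A \<inter> B) \<union> (B - A \<inter> B)" "(A - A \<inter> B) \<inter> (B - A \<inter> B) = {}" by auto
  then have "dg (sym_diff A B) a v = dg (A - A \<inter> B) a v + dg (B - A \<inter> B) a v"
    using assms by (simp only: wdeg_Un finite_Diff)
  also have "\<dots> = dg A a v + dg B a v - 2 * dg (A \<inter> B) a v"
    unfolding wdeg_diff[OF assms(1) Int_lower1] wdeg_diff[OF assms(2) Int_lower2] by simp
  finally show ?thesis by simp
qed

lemma path_join:
  assumes "finite X" "(x, y) \<in> conn a X"
  shows "\<exists>J\<subseteq>X. \<forall>z. odd (dg J a z) \<longleftrightarrow> ((z = x) \<noteq> (z = y))"
  using assms(2)
proof (induction rule: rtrancl_induct)
  case base
  show ?case by (intro exI[of _ "{}"]) auto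
next
  case (step y z)
  then obtain J where J: "J \<subseteq> X" "\<And>u. odd (dg J a u) \<longleftrightarrow> ((u = x) \<noteq> (u = y))" by blast
  obtain e b where e: "e \<in> X" "y = a e b" "z = a e (\<not> b)" using step.hyps(2) by (auto simp: adj_def)
  have de: "odd (dg {e} a u) \<longleftrightarrow> ((u = y) \<noteq> (u = z))" for u
    using e(2,3) by (cases b) (auto simp: wdeg_insert)
  have "finite J" using J(1) assms(1) finite_subset by auto
  then have "odd (dg (sym_diff J {e}) a u) \<longleftrightarrow> ((u = x) \<noteq> (u = z))" for u
    using even_dg_sym_diff[of J "{e}" a u] J(2)[of u] de[of u] by auto
  then show ?case using J(1) e(1) by (intro exI[of _ "sym_diff J {e}"]) auto
qed

text \<open>
  Symmetric differences of paths that pair up the elements of \<open>R\<close>.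
\<close>

lemma join_exists:
  assumes "finite X" "finite R" "even (card R)" "\<And>x y. x \<in> R \<Longrightarrow> y \<in> R \<Longrightarrow> (x, y) \<in> conn a X"
  shows "\<exists>J\<subseteq>X. \<forall>z. odd (dg J a z) \<longleftrightarrow> z \<in> R"
  using assms(2-4)
proof (induction "card R" arbitrary: R rule: less_induct)
  case less
  show ?case
  proof (cases "R = {}")
    case True
    then show ?thesis by (intro exI[of _ "{}"]) auto
  next
    case False
    then obtain x where x: "x \<in> R" by auto
    have "R \<noteq> {x}" using less.prems(2) by auto
    then obtain y where y: "y \<in> R" "y \<noteq> x" using x by auto
    define R' where "R' = R - {x, y}"
    have R: "R = insert x (insert y R')" "x \<notin> R'" "y \<notin> R'" using x y by (auto simp: R'_def)
    have fR': "finite R'" using less.prems(1) by (simp add: R'_def)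
    have c: "card R = Suc (Suc (card R'))" using R fR' y by simp
    obtain J where J: "J \<subseteq> X" "\<forall>z. odd (dg J a z) \<longleftrightarrow> z \<in> R'"
      using less.hyps[of R'] c fR' less.prems(2,3) by (auto simp: R'_def)
    obtain P where P: "P \<subseteq> X" "\<forall>z. odd (dg P a z) \<longleftrightarrow> ((z = x) \<noteq> (z = y))"
      using path_join[OF assms(1) less.prems(3)[OF x y(1)]] by blast
    have f: "finite J" "finite P" using J(1) P(1) assms(1) finite_subset by auto
    have "odd (dg (sym_diff J P) a z) \<longleftrightarrow> z \<in> R" for z
      using even_dg_sym_diff[OF f, of a z] J(2) P(2) R y(2) by auto
    then show ?thesis using J(1) P(1) by (intro exI[of _ "sym_diff J P"]) auto
  qed
qed

section \<open>Colourings with prescribed parities\<close>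

lemma sum_colour_dg:
  assumes "finite E" "finite I" "\<And>e. e \<in> E \<Longrightarrow> c e \<in> I"
  shows "(\<Sum>i\<in>I. dg {e \<in> E. c e = i} a v) = dg E a v"
proof -
  have "dg E a v = (\<Sum>i\<in>I. \<Sum>e\<in>{e \<in> E. c e = i}. (if a e True = v then 1 else 0) + (if a e False = v then 1 else 0))"
    unfolding wdeg_def by (rule sum.group[symmetric]) (use assms in auto)
  then show ?thesis by (simp add: wdeg_def)
qed

text \<open>
  A colouring that is correct outside \<open>U\<close>, and correct for \<open>U\<close> as a whole, is corrected inside \<open>U\<close>.
  For every positive colour one of the connected subgraphs contains a join that repairs all parities of
  this colour in \<open>U\<close>. The other edges of the subgraphs are given the colour 0, which needs no
  subgraph of its own: its parities follow from those of the degrees and of the other colours.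
\<close>

lemma extend_colouring:
  fixes a :: "'e \<Rightarrow> bool \<Rightarrow> 'v" and k :: nat
  assumes "1 \<le> k" "finite E" "finite V" "U \<subseteq> V"
    and par: "\<And>v. v \<in> V \<Longrightarrow> even (dg E a v) \<longleftrightarrow> even k \<or> v \<notin> T"
    and c': "\<And>e. c' e < k" "\<And>v i. v \<in> V - U \<Longrightarrow> i < k \<Longrightarrow> odd (dg {e \<in> E. c' e = i} a v) \<longleftrightarrow> v \<in> T"
      "\<And>i. i < k \<Longrightarrow> even (\<Sum>x\<in>U. dg {e \<in> E. c' e = i} a x) \<longleftrightarrow> even (card (U \<inter> T))"
    and F: "\<And>i. i < k - 1 \<Longrightarrow> F i \<subseteq> {e \<in> E. \<forall>b. a e b \<in> U}"
      "\<And>i j. i < k - 1 \<Longrightarrow> j < k - 1 \<Longrightarrow> i \<noteq> j \<Longrightarrow> F i \<inter> F j = {}"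
      "\<And>i x y. i < k - 1 \<Longrightarrow> x \<in> U \<Longrightarrow> y \<in> U \<Longrightarrow> (x, y) \<in> conn a (F i)"
  shows "\<exists>c. (\<forall>e. c e < k) \<and> (\<forall>v\<in>V. \<forall>i<k. odd (dg {e \<in> E. c e = i} a v) \<longleftrightarrow> v \<in> T)"
proof -
  define Fs where "Fs = (\<Union>i<k-1. F i)"
  have Fs: "Fs \<subseteq> E" "\<And>e b. e \<in> Fs \<Longrightarrow> a e b \<in> U" using F(1) by (fastforce simp: Fs_def)+
  have finU: "finite U" using assms(3,4) finite_subset by auto
  define N where "N i = {e \<in> E - Fs. c' e = i}" for i
  have finN: "finite (N i)" for i using assms(2) by (simp add: N_def)
  have N_split: "dg {e \<in> E. c' e = i} a x = dg (N i) a x + dg {e \<in> Fs. c' e = i} a x" for i x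
  proof -
    have "N i = {e \<in> E. c' e = i} - {e \<in> Fs. c' e = i}" by (auto simp: N_def)
    moreover have "{e \<in> Fs. c' e = i} \<subseteq> {e \<in> E. c' e = i}" using Fs(1) by auto
    ultimately show ?thesis using wdeg_diff[of "{e \<in> E. c' e = i}" "{e \<in> Fs. c' e = i}" a "\<lambda>_ _. 1" x] assms(2)
      by simp
  qed
  have "\<exists>J\<subseteq>F i. \<forall>z. odd (dg J a z) \<longleftrightarrow> z \<in> {x \<in> U. odd (dg (N (Suc i)) a x) \<noteq> (x \<in> T)}" 
    if i: "i < k - 1" for i
  proof (rule join_exists)
    show "finite (F i)" using F(1)[OF i] assms(2) finite_subset by fastforce
    show "finite {x \<in> U. odd (dg (N (Suc i)) a x) \<noteq> (x \<in> T)}" using finU by simp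
    have "(\<Sum>x\<in>U. dg {e \<in> E. c' e = Suc i} a x) = (\<Sum>x\<in>U. dg (N (Suc i)) a x + dg {e \<in> Fs. c' e = Suc i} a x)"
    proof (rule sum.cong[OF refl])
      fix x
      show "dg {e \<in> E. c' e = Suc i} a x = dg (N (Suc i)) a x + dg {e \<in> Fs. c' e = Suc i} a x"
        by (rule N_split)
    qed
    also have "\<dots> = (\<Sum>x\<in>U. dg (N (Suc i)) a x) + 2 * int (card {e \<in> Fs. c' e = Suc i})"
      unfolding sum.distrib using sum_dg_inside[OF finU, of "{e \<in> Fs. c' e = Suc i}" a] Fs(2) by simp
    finally have e1: "even (\<Sum>x\<in>U. dg (N (Suc i)) a x) \<longleftrightarrow> even (card (U \<inter> T))"
      using c'(3)[of "Suc i"] i by simp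
    have "(\<Sum>x\<in>U. dg (N (Suc i)) a x + of_bool (x \<in> T)) = (\<Sum>x\<in>U. dg (N (Suc i)) a x) + int (card (U \<inter> T))"
      using finU by (simp add: sum.distrib sum.If_cases of_bool_def Int_def)
    with e1 have "even (\<Sum>x\<in>U. dg (N (Suc i)) a x + of_bool (x \<in> T))" by simp
    moreover have "{x \<in> U. odd (dg (N (Suc i)) a x + of_bool (x \<in> T))} = {x \<in> U. odd (dg (N (Suc i)) a x) \<noteq> (x \<in> T)}"
      by auto
    ultimately show "even (card {x \<in> U. odd (dg (N (Suc i)) a x) \<noteq> (x \<in> T)})"
      unfolding even_sum_iff[OF finU] by simp
  qed (use F(3)[OF i] in auto)
  then obtain J where J: "\<And>i. i < k - 1 \<Longrightarrow> J i \<subseteq> F i"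
    "\<And>i z. i < k - 1 \<Longrightarrow> odd (dg (J i) a z) \<longleftrightarrow> z \<in> U \<and> odd (dg (N (Suc i)) a z) \<noteq> (z \<in> T)"
    by (atomize_elim, subst all_conj_distrib[symmetric]) (simp, metis)
  define idx where "idx e = (THE i. i < k - 1 \<and> e \<in> F i)" for e
  have idx: "idx e = i" if "i < k - 1" "e \<in> F i" for e i
    unfolding idx_def by (rule the_equality) (use that F(2) in blast)+
  define c where "c e = (if e \<in> Fs then if e \<in> J (idx e) then Suc (idx e) else 0 else c' e)" for e
  have ck: "c e < k" for e
    using c'(1)[of e] assms(1) idx by (auto simp: c_def Fs_def)
  have N: "{e \<in> E. c e = Suc i} = N (Suc i) \<union> J i" if i: "i < k - 1" for i
  proof
    show "{e \<in> E. c e = Suc i} \<subseteq> N (Suc i) \<union> J i" by (auto simp: c_def N_def)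
    show "N (Suc i) \<union> J i \<subseteq> {e \<in> E. c e = Suc i}"
      using J(1)[OF i] idx[OF i] i Fs(1) by (auto simp: c_def N_def Fs_def)
  qed
  have suc: "odd (dg {e \<in> E. c e = Suc i} a v) \<longleftrightarrow> v \<in> T" if v: "v \<in> V" and i: "i < k - 1" for v i
  proof -
    have JF: "J i \<subseteq> Fs" using J(1)[OF i] i by (auto simp: Fs_def)
    have "finite (J i)" by (rule finite_subset[OF subset_trans[OF JF Fs(1)] assms(2)])
    then have d: "dg {e \<in> E. c e = Suc i} a v = dg (N (Suc i)) a v + dg (J i) a v"
      unfolding N[OF i] by (intro wdeg_Un finN) (use JF in \<open>auto simp: N_def\<close>)
    show ?thesis
    proof (cases "v \<in> U")
      case True
      then show ?thesis using d J(2)[OF i, of v] by auto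
    next
      case False
      have "dg {e \<in> E. c' e = Suc i} a v = dg (N (Suc i)) a v"
      proof -
        have "dg {e \<in> Fs. c' e = Suc i} a v = 0"
          by (rule wdeg_untouched) (use Fs(2) False in blast)
        then show ?thesis using N_split[of "Suc i" v] by simp
      qed
      then show ?thesis using d J(2)[OF i, of v] c'(2)[of v "Suc i"] False v i by auto
    qed
  qed
  have zero: "odd (dg {e \<in> E. c e = 0} a v) \<longleftrightarrow> v \<in> T" if v: "v \<in> V" for v
  proof -
    obtain q where q: "k = Suc q" using assms(1) by (cases k) auto
    have "dg E a v = dg {e \<in> E. c e = 0} a v + (\<Sum>i<q. dg {e \<in> E. c e = Suc i} a v)"
      using sum_colour_dg[OF assms(2), of "{..<k}" c a v] ck unfolding q by (simp del: sum.lessThan_Suc add: sum.lessThan_Suc_shift)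
    moreover have "even (\<Sum>i<q. dg {e \<in> E. c e = Suc i} a v) \<longleftrightarrow> even q \<or> v \<notin> T"
    proof -
      have "{i \<in> {..<q}. odd (dg {e \<in> E. c e = Suc i} a v)} = (if v \<in> T then {..<q} else {})"
        using suc[OF v] q by auto
      then show ?thesis by (simp add: even_sum_iff)
    qed
    ultimately show ?thesis using par[OF v] q by auto
  qed
  have "odd (dg {e \<in> E. c e = i} a v) \<longleftrightarrow> v \<in> T" if "v \<in> V" "i < k" for v i
    using suc[of v "i - 1"] zero that by (cases i) auto
  then show ?thesis using ck by blast
qed

text \<open>
  Induction on the size of the graph, in which loops can be deleted. If an edge ends at a vertex
  outside \<open>T\<close>, a pair of edges at this vertex is lifted, and both pieces of the spliced edge inherit
  its colour. If \<open>T\<close> contains all vertices, then all degrees are at least \<open>l\<close>, so that for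
  \<open>k > 1\<close> there are more than \<open>(k - 1) (|V| - 1)\<close> edges. Hence there is a set \<open>U\<close> with
  \<open>k - 1\<close> disjoint connected subgraphs on it. Contracting \<open>U\<close> to one vertex keeps the hypotheses, whatever the parity of \<open>U\<close>, and a colouring of the contracted graph extends.
\<close>

lemma parity_colouring:
  fixes a :: "'e \<Rightarrow> bool \<Rightarrow> 'v" and k :: nat and l :: int
  assumes k: "1 \<le> k" and l: "2 * int k - 2 \<le> l" "even (l + int k)"
    and "finite E" "finite V" "\<And>e b. e \<in> E \<Longrightarrow> a e b \<in> V" "T \<subseteq> V"
    and "\<And>v. v \<in> V \<Longrightarrow> even (dg E a v) \<longleftrightarrow> even k \<or> v \<notin> T"
    and "\<And>X. X \<subseteq> V \<Longrightarrow> odd (card (X \<inter> T)) \<Longrightarrow> l \<le> cut_card E a X"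
  shows "\<exists>c. (\<forall>e. c e < k) \<and> (\<forall>v\<in>V. \<forall>i<k. odd (dg {e \<in> E. c e = i} a v) \<longleftrightarrow> v \<in> T)"
  using assms(4-)
proof (induction "card E + card V" arbitrary: E V T a rule: less_induct)
  case less
  note fin = less.prems(1,2) and ends = less.prems(3) and TV = less.prems(4) and par = less.prems(5)
    and con = less.prems(6)
  have l0: "0 < l" using k l by (cases "k = 1") (auto, presburger)
  consider (one) "k = 1" | (loop) e where "e \<in> E" "a e True = a e False"
    | (isolated) v where "v \<in> V" "v \<notin> T" "\<And>e b. e \<in> E \<Longrightarrow> a e b \<noteq> v"
    | (lift) v e b where "\<And>e. e \<in> E \<Longrightarrow> a e True \<noteq> a e False" "v \<in> V" "v \<notin> T" "e \<in> E" "a e b = v"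
    | (empty) "V = {}"
    | (all) "1 < k" "\<And>e. e \<in> E \<Longrightarrow> a e True \<noteq> a e False" "T = V" "V \<noteq> {}"
    using k TV by (metis le_neq_implies_less subset_antisym subsetI)
  then show ?case
  proof cases
    case one
    then show ?thesis using par by (intro exI[of _ "\<lambda>_. 0"]) auto
  next
    case empty
    then show ?thesis using k by (intro exI[of _ "\<lambda>_. 0"]) auto
  next
    case loop
    have "card (E - {e}) < card E" by (rule card_Diff1_less[OF fin(1) loop(1)])
    moreover have "even (dg (E - {e}) a v) \<longleftrightarrow> even k \<or> v \<notin> T" if "v \<in> V" for v
      using par[OF that] loop by (auto simp: wdeg_remove[OF fin(1) loop(1)])
    moreover have "cut_card (E - {e}) a X = cut_card E a X" for X
      using cut_remove[OF fin(1) loop(1), of a X] loop(2) by simp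
    ultimately obtain c where c: "\<forall>e. c e < k" "\<forall>v\<in>V. \<forall>i<k. odd (dg {e' \<in> E - {e}. c e' = i} a v) \<longleftrightarrow> v \<in> T"
      using less.hyps[of "E - {e}" V a T] fin ends TV con by auto
    have "odd (dg {e \<in> E. c e = i} a v) \<longleftrightarrow> odd (dg {e' \<in> E - {e}. c e' = i} a v)" for i v
    proof (cases "c e = i")
      case True
      then have "{e \<in> E. c e = i} = insert e {e' \<in> E - {e}. c e' = i}" using loop(1) by auto
      then show ?thesis using loop(2) fin(1) by (simp add: wdeg_insert)
    next
      case False
      then have "{e \<in> E. c e = i} = {e' \<in> E - {e}. c e' = i}" by auto
      then show ?thesis by simp
    qed
    then show ?thesis using c by blast
  next
    case isolated
    have "card (V - {v}) < card V" by (rule card_Diff1_less[OF fin(2) isolated(1)])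
    then obtain c where c: "\<forall>e. c e < k" "\<forall>u\<in>V - {v}. \<forall>i<k. odd (dg {e \<in> E. c e = i} a u) \<longleftrightarrow> u \<in> T"
      using less.hyps[of E "V - {v}" a T] fin ends TV par con isolated by (auto simp: subset_iff)
    have "dg {e \<in> E. c e = i} a v = 0" for i by (rule wdeg_untouched) (use isolated(3) in auto)
    then have "odd (dg {e \<in> E. c e = i} a u) \<longleftrightarrow> u \<in> T" if "u \<in> V" "i < k" for u i
      using c(2) that isolated(2) by (cases "u = v") auto
    then show ?thesis using c(1) by blast
  next
    case lift
    obtain e' b' where e': "e' \<in> E" "e' \<noteq> e" "a e' b' = v"
      "\<And>X. X \<subseteq> V \<Longrightarrow> odd (card (X \<inter> T)) \<Longrightarrow> l \<le> cut_card (E - {e'}) (merge a e b e' b') X"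
      using liftable_pair[OF fin ends TV par l(2) l0 con lift] by blast
    let ?a = "merge a e b e' b'"
    have "card (E - {e'}) < card E" by (rule card_Diff1_less[OF fin(1) e'(1)])
    moreover have "?a f d \<in> V" if "f \<in> E - {e'}" for f d
      using that ends e'(1) by (auto simp: merge_def)
    moreover have "even (dg (E - {e'}) ?a u) \<longleftrightarrow> even k \<or> u \<notin> T" if "u \<in> V" for u
    proof -
      have "insert e' (E - {e'}) = E" using e'(1) by auto
      then have "dg E a u = dg (E - {e'}) ?a u + (if u = v then 2 else 0)"
        using dg_merge[of "E - {e'}" e' a e b v b' u] fin(1) lift(4,5) e'(2,3) by auto
      then show ?thesis using par[OF that] by (auto split: if_splits)
    qed
    ultimately obtain c where c: "\<forall>e. c e < k" 
      "\<forall>u\<in>V. \<forall>i<k. odd (dg {f \<in> E - {e'}. c f = i} ?a u) \<longleftrightarrow> u \<in> T"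
      using less.hyps[of "E - {e'}" V ?a T] fin TV e'(4) by auto
    define d where "d = c(e' := c e)"
    have "odd (dg {f \<in> E. d f = i} a u) \<longleftrightarrow> u \<in> T" if "u \<in> V" "i < k" for u i
    proof -
      let ?D = "{f \<in> E - {e'}. c f = i}"
      have "{f \<in> E. d f = i} = (if e \<in> ?D then insert e' ?D else ?D)"
        using e'(1,2) lift(4) by (auto simp: d_def)
      then have "dg {f \<in> E. d f = i} a u = dg ?D ?a u + (if e \<in> ?D \<and> u = v then 2 else 0)"
        using dg_merge[of ?D e' a e b v b' u] fin(1) lift(5) e'(3) by auto
      then show ?thesis using c(2) that by (auto split: if_splits)
    qed
    moreover have "d f < k" for f using c(1) by (simp add: d_def)
    ultimately show ?thesis by blast
  next
    case all
    have cut1: "cut_card E a {v} = dg E a v" for v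
      unfolding cut_card_def wdeg_def
    proof (rule sum.cong[OF refl])
      fix e assume "e \<in> E"
      from all(2)[OF this] show "of_bool ((a e True \<in> {v}) \<noteq> (a e False \<in> {v})) =
        (if a e True = v then 1 else 0) + (if a e False = v then 1 else (0 :: int))" by auto
    qed
    have "(k - 1) * (card V - 1) < card E"
    proof -
      have "(\<Sum>v\<in>V. 2 * (int k - 1)) \<le> (\<Sum>v\<in>V. dg E a v)"
      proof (rule sum_mono)
        fix v assume "v \<in> V"
        then have "l \<le> cut_card E a {v}" using con[of "{v}"] all(3) by auto
        then show "2 * (int k - 1) \<le> dg E a v" using l(1) cut1 by simp
      qed
      also have "\<dots> = 2 * int (card E)" by (rule sum_dg_inside[OF fin(2) ends])
      finally have "2 * (int (card V) * (int k - 1)) \<le> 2 * int (card E)" by (simp add: algebra_simps)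
      then have "int (card V) * (int k - 1) \<le> int (card E)" by linarith
      moreover have "(int (card V) - 1) * (int k - 1) < int (card V) * (int k - 1)" using all(1) by simp
      ultimately have "(int (card V) - 1) * (int k - 1) < int (card E)" by linarith
      moreover have "int ((k - 1) * (card V - 1)) = (int (card V) - 1) * (int k - 1)"
        using all(1,4) fin(2) by (simp add: of_nat_diff card_gt_0_iff Suc_le_eq)
      ultimately show ?thesis by linarith
    qed
    from dense_spanning_packing[of E V a "k - 1", OF fin all(4) ends all(2) this] obtain U F where
      UV: "U \<subseteq> V" and U2: "2 \<le> card U" and F: "\<And>i. i < k - 1 \<Longrightarrow> F i \<subseteq> {e \<in> E. \<forall>b. a e b \<in> U}"
        "\<And>i j. i < k - 1 \<Longrightarrow> j < k - 1 \<Longrightarrow> i \<noteq> j \<Longrightarrow> F i \<inter> F j = {}"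
        "\<And>i x y. i < k - 1 \<Longrightarrow> x \<in> U \<Longrightarrow> y \<in> U \<Longrightarrow> (x, y) \<in> conn a (F i)" by blast
    have finU: "finite U" using UV fin(2) finite_subset by auto
    obtain u where u: "u \<in> U" using U2 by fastforce
    \<comment> \<open>Contraction of \<open>U\<close> to \<open>u\<close>; the edges inside \<open>U\<close> become loops, whose colours do not affect
       parities.\<close>
    define f where "f x = (if x \<in> U then u else x)" for x
    define a' where "a' e b = f (a e b)" for e b
    define V' where "V' = insert u (V - U)"
    define T' where "T' = (V - U) \<union> (if odd (card U) then {u} else {})"
    have uV: "u \<in> V" using u UV by auto
    have out: "dg D a' v = dg D a v" if "v \<notin> U" for D v
      by (rule wdeg_cong) (use that u in \<open>auto simp: a'_def f_def\<close>)
    have inside: "dg D a' u = (\<Sum>x\<in>U. dg D a x)" for D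
    proof -
      show ?thesis unfolding sum_dg[OF finU]
        unfolding wdeg_def by (rule sum.cong) (use u in \<open>auto simp: a'_def f_def\<close>)
    qed
    have "card V' < card V"
    proof -
      have "card V' = Suc (card (V - U))" using fin(2) u by (simp add: V'_def)
      also have "\<dots> = Suc (card V - card U)" using card_Diff_subset[OF finU UV] by simp
      also have "\<dots> < card V" using U2 card_mono[OF fin(2) UV] by linarith
      finally show ?thesis .
    qed
    moreover have "finite V'" using fin(2) by (simp add: V'_def)
    moreover have "a' e b \<in> V'" if "e \<in> E" for e b
      using ends[OF that] by (auto simp: a'_def f_def V'_def)
    moreover have "T' \<subseteq> V'" by (auto simp: T'_def V'_def)
    moreover have "even (dg E a' v) \<longleftrightarrow> even k \<or> v \<notin> T'" if "v \<in> V'" for v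
    proof (cases "v = u")
      case True
      have "even (dg E a' u) \<longleftrightarrow> even k \<or> even (card (U \<inter> T))"
        unfolding inside by (rule even_sum_dg[OF finU UV par])
      then show ?thesis using True u UV all(3) by (auto simp: T'_def Int_absorb2)
    next
      case False
      then have "v \<in> V - U" using that by (auto simp: V'_def)
      then show ?thesis using out[of v E] par[of v] False all(3) by (auto simp: T'_def)
    qed
    moreover have "l \<le> cut_card E a' X" if X: "X \<subseteq> V'" "odd (card (X \<inter> T'))" for X
    proof -
      define Y where "Y = {x \<in> V. f x \<in> X}"
      have "cut_card E a' X = cut_card E a Y"
        by (rule cut_cong) (use ends in \<open>auto simp: a'_def Y_def\<close>)
      moreover have "odd (card Y)"
      proof (cases "u \<in> X")
        case False
        then have "Y = X" "X \<inter> T' = X" using X(1) u by (auto simp: Y_def f_def V'_def T'_def)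
        then show ?thesis using X(2) by simp
      next
        case True
        have fX: "finite (X - {u})" using X(1) fin(2) finite_subset[of X V'] by (auto simp: V'_def)
        have "Y = (X - {u}) \<union> U" "(X - {u}) \<inter> U = {}"
          using True X(1) u UV by (auto simp: Y_def f_def V'_def)
        then have "card Y = card (X - {u}) + card U" using card_Un_disjoint[OF fX finU] by simp
        moreover have "X \<inter> T' = (if odd (card U) then insert u (X - {u}) else X - {u})"
          using True X(1) u by (auto simp: T'_def V'_def)
        moreover have "card (insert u (X - {u})) = Suc (card (X - {u}))"
          by (rule card_insert_disjoint[OF fX]) simp
        ultimately show ?thesis using X(2) by (simp del: insert_Diff_single split: if_splits)
      qed
      moreover have "Y \<subseteq> V" by (auto simp: Y_def)
      ultimately show ?thesis using con[of Y] all(3) by (simp add: Int_absorb2)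
    qed
    ultimately have "\<exists>c. (\<forall>e. c e < k) \<and> (\<forall>v\<in>V'. \<forall>i<k. odd (dg {e \<in> E. c e = i} a' v) \<longleftrightarrow> v \<in> T')"
      using fin(1) by (intro less.hyps) auto
    then obtain c where c: "\<And>e. c e < k" 
      "\<And>v i. v \<in> V' \<Longrightarrow> i < k \<Longrightarrow> odd (dg {e \<in> E. c e = i} a' v) \<longleftrightarrow> v \<in> T'"
      by blast
    show ?thesis
    proof (rule extend_colouring[OF k fin UV par _ _ _ F])
      show "c e < k" for e by (rule c(1))
      show "odd (dg {e \<in> E. c e = i} a v) \<longleftrightarrow> v \<in> T" if "v \<in> V - U" "i < k" for v i
      proof -
        have "v \<noteq> u" using that u by auto
        then show ?thesis using c(2)[of v i] that out[of v] all(3) by (auto simp: V'_def T'_def)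
      qed
      show "even (\<Sum>x\<in>U. dg {e \<in> E. c e = i} a x) \<longleftrightarrow> even (card (U \<inter> T))" if "i < k" for i
      proof -
        have "u \<in> T' \<longleftrightarrow> odd (card U)" and "u \<in> V'" and "U \<inter> T = U"
          using u UV all(3) by (auto simp: T'_def V'_def)
        then show ?thesis using c(2)[of u i] that unfolding inside by simp
      qed
    qed
  qed
qed

section \<open>From parities to bounded degrees\<close>

lemma sum_window:
  fixes d :: "nat \<Rightarrow> int"
  assumes "i < k" "\<And>j. j < k \<Longrightarrow> d i - 2 \<le> d j"
  shows "int k * (d i - 2) + 2 \<le> (\<Sum>j<k. d j)"
proof -
  have "(\<Sum>j<k. d j) = d i + (\<Sum>j\<in>{..<k} - {i}. d j)" using assms(1) by (simp add: sum.remove)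
  moreover have "(\<Sum>j\<in>{..<k} - {i}. d i - 2) \<le> (\<Sum>j\<in>{..<k} - {i}. d j)"
    by (rule sum_mono) (use assms(2) in auto)
  moreover have "(\<Sum>j\<in>{..<k} - {i}. d i - 2) = (int k - 1) * (d i - 2)"
    using assms(1) by (simp add: of_nat_diff)
  ultimately show ?thesis by (simp add: algebra_simps)
qed

text \<open>
  The graph with an additional vertex \<open>None\<close> and, for some vertices \<open>v\<close>, an additional edge \<open>Inr v\<close>
  between \<open>v\<close> and \<open>None\<close>. It serves to correct the parity of degrees.
\<close>

definition hang :: "('e \<Rightarrow> bool \<Rightarrow> 'v) \<Rightarrow> 'e + 'v \<Rightarrow> bool \<Rightarrow> 'v option" where
  "hang a x b = (case x of Inl e \<Rightarrow> Some (a e b) | Inr v \<Rightarrow> if b then Some v else None)"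

lemma dg_hang:
  assumes "finite E" "finite B"
  shows "dg (Inl ` E \<union> Inr ` B) (hang a) (Some v) = dg E a v + of_bool (v \<in> B)"
proof -
  have "dg (Inl ` E \<union> Inr ` B) (hang a) (Some v) = dg (Inl ` E) (hang a) (Some v) + dg (Inr ` B) (hang a) (Some v)"
    by (rule wdeg_Un) (use assms in auto)
  also have "dg (Inl ` E) (hang a) (Some v) = dg E a v"
    unfolding wdeg_def by (subst sum.reindex) (auto simp: hang_def)
  also have "dg (Inr ` B) (hang a) (Some v) = (\<Sum>u\<in>B. if u = v then 1 else 0)"
    unfolding wdeg_def by (subst sum.reindex) (auto simp: hang_def intro: sum.cong)
  also have "\<dots> = of_bool (v \<in> B)" using assms(2) by simp
  finally show ?thesis .
qed

lemma dg_hang_colour: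
  assumes "finite E" "finite B"
  shows "dg {x \<in> Inl ` E \<union> Inr ` B. c x = i} (hang a) (Some v) =
    dg {e \<in> E. c (Inl e) = i} a v + of_bool (v \<in> B \<and> c (Inr v) = i)"
proof -
  have "{x \<in> Inl ` E \<union> Inr ` B. c x = i} = Inl ` {e \<in> E. c (Inl e) = i} \<union> Inr ` {v \<in> B. c (Inr v) = i}" by auto
  then show ?thesis using dg_hang[of "{e \<in> E. c (Inl e) = i}" "{v \<in> B. c (Inr v) = i}" a v] assms by simp
qed

text \<open>
  Petersen's theorem on 2-factors, with bounds in place of regularity. After correction of the odd
  degrees, the colouring with a single colour has only even colour degrees. A balanced recolouring
  keeps them even. A colour degree of at least 4 would force all the others to be at least 2, and the
  degree would exceed \<open>2 r\<close>.
\<close>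

lemma degree_two_classes:
  fixes a :: "'e \<Rightarrow> bool \<Rightarrow> 'v"
  assumes "finite E" "\<And>v. dg E a v \<le> 2 * int r"
  shows "\<exists>c. (\<forall>e\<in>E. c e < r) \<and> (\<forall>v. \<forall>i<r. dg {e \<in> E. c e = i} a v \<le> 2)"
proof (cases "r = 0")
  case True
  have "E = {}"
  proof (rule ccontr)
    assume "E \<noteq> {}"
    then obtain e where "e \<in> E" by auto
    then show False using dg_pos[OF assms(1), of e a True] assms(2)[of "a e True"] True by auto
  qed
  then show ?thesis using True by simp
next
  case False
  define B where "B = {v. odd (dg E a v)}"
  have "B \<subseteq> (\<Union>e\<in>E. range (a e))"
  proof
    fix v assume "v \<in> B"
    then have "dg E a v \<noteq> 0" by (auto simp: B_def)
    then show "v \<in> (\<Union>e\<in>E. range (a e))" using dg_touched[of E a v] by auto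
  qed
  then have finB: "finite B" by (rule finite_subset) (use assms(1) in auto)
  define E' where "E' = (Inl ` E \<union> Inr ` B :: ('e + 'v) set)"
  have finE': "finite E'" using assms(1) finB by (simp add: E'_def)
  have dE': "dg E' (hang a) (Some v) = dg E a v + of_bool (v \<in> B)" for v
    unfolding E'_def by (rule dg_hang[OF assms(1) finB])
  have "even (dg {x \<in> E'. 0 = i} (hang a) u) \<longleftrightarrow> even (dg {x \<in> E'. 0 = j} (hang a) u)"
    if "u \<in> range Some" for u and i j :: nat
    using that dE' by (cases "i = 0"; cases "j = 0") (auto simp: B_def)
  from balanced_recolouring[OF finE', of "\<lambda>_. 0" r "range Some" "hang a", OF _ this] obtain c where
    c: "\<forall>x\<in>E'. c x < r" "\<forall>v\<in>range Some. \<forall>i<r. even (dg {x \<in> E'. c x = i} (hang a) v) \<longleftrightarrow>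
        even (dg {x \<in> E'. 0 = i} (hang a) v)"
      "\<forall>v. \<forall>i<r. \<forall>j<r. \<bar>dg {x \<in> E'. c x = i} (hang a) v - dg {x \<in> E'. c x = j} (hang a) v\<bar> \<le> 2"
    using False by auto
  have "dg {e \<in> E. c (Inl e) = i} a v \<le> 2" if i: "i < r" for v i
  proof -
    define d where "d j = dg {x \<in> E'. c x = j} (hang a) (Some v)" for j
    have sum: "(\<Sum>j<r. d j) \<le> 2 * int r"
    proof -
      have "(\<Sum>j<r. d j) = dg E' (hang a) (Some v)"
        unfolding d_def by (rule sum_colour_dg) (use c(1) finE' in auto)
      then show ?thesis using dE'[of v] assms(2)[of v] by (cases "v \<in> B") (auto simp: B_def, presburger)
    qed
    have ev: "even (d i)" unfolding d_def using c(2) i dE'[of v] by (cases "i = 0") (auto simp: B_def)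
    have "d i - 2 \<le> d j" if "j < r" for j
    proof -
      have "\<bar>d i - d j\<bar> \<le> 2" using c(3) i that unfolding d_def by blast
      then show ?thesis by linarith
    qed
    then have "int r * (d i - 2) + 2 \<le> 2 * int r" using sum_window[OF i, of d] sum by fastforce
    moreover have "int r * 2 \<le> int r * (d i - 2)" if "4 \<le> d i" using that by (intro mult_left_mono) auto
    ultimately have "d i < 4" by linarith
    then have "d i \<le> 2" using ev by presburger
    moreover have "dg {e \<in> E. c (Inl e) = i} a v \<le> d i"
      unfolding d_def E'_def dg_hang_colour[OF assms(1) finB] by simp
    ultimately show ?thesis by linarith
  qed
  then show ?thesis using c(1) by (intro exI[of _ "\<lambda>e. c (Inl e)"]) (auto simp: E'_def)
qed

text \<open>
  The vertices outside \<open>U\<close> are contracted to a single vertex, which is also used to correct the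
  parities of the degrees in \<open>U\<close> to that of \<open>k\<close>; then the parity colouring applies, with \<open>T\<close>
  containing \<open>U\<close>. Balancing takes place in the uncontracted graph. The colour degrees at a vertex are
  then at most 2 apart. If one of them exceeds \<open>p\<close>, then the degree is at least \<open>k (p - 1) + 2\<close>, which is
  excluded outside \<open>U\<close>. In \<open>U\<close> all colour degrees are odd, so that it is at least \<open>p + 2\<close>, and
  the degree is at least \<open>k p + 2\<close>.
\<close>

lemma odd_degree_classes:
  fixes a :: "'e \<Rightarrow> bool \<Rightarrow> 'v" and k p :: nat
  assumes k: "1 \<le> k" and p: "odd p" and finE: "finite E" and finU: "finite U"
    and full: "\<And>v. v \<in> U \<Longrightarrow> dg E a v \<le> int (k * p)"
    and slack: "\<And>v. v \<notin> U \<Longrightarrow> dg E a v \<le> int (k * p) - int k + 1"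
    and con: "\<And>A. A \<subseteq> U \<Longrightarrow> odd (card A) \<Longrightarrow> 2 * int k - 2 \<le> cut_card E a A"
  shows "\<exists>c. (\<forall>e\<in>E. c e < k) \<and> (\<forall>v. \<forall>i<k. dg {e \<in> E. c e = i} a v \<le> int p)"
proof -
  define B where "B = {v \<in> U. odd (dg E a v + int k)}"
  have finB: "finite B" using finU by (simp add: B_def)
  define E' where "E' = (Inl ` E \<union> Inr ` B :: ('e + 'v) set)"
  have finE': "finite E'" using finE finB by (simp add: E'_def)
  define f where "f o' = (if o' \<in> Some ` U then o' else None)" for o' :: "'v option"
  define g where "g x b = f (hang a x b)" for x b
  have g_hang: "dg D g (Some v) = dg D (hang a) (Some v)" if "v \<in> U" for D v
    by (rule wdeg_cong) (use that in \<open>auto simp: g_def f_def\<close>)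
  have dE': "dg E' (hang a) (Some v) = dg E a v + of_bool (v \<in> B)" for v
    unfolding E'_def by (rule dg_hang[OF finE finB])
  define V where "V = insert None (Some ` U)"
  define T where "T = Some ` U \<union> (if odd (card U) then {None} else {})"
  have finV: "finite V" using finU by (simp add: V_def)
  have TV: "T \<subseteq> V" by (auto simp: V_def T_def)
  have ends: "g x b \<in> V" for x b by (auto simp: g_def f_def V_def)
  have parU: "even (dg E' g v) \<longleftrightarrow> even k \<or> v \<notin> T" if v: "v \<in> Some ` U" for v
  proof -
    obtain u where u: "u \<in> U" "v = Some u" using v by auto
    have "even (dg E' g v) \<longleftrightarrow> even k"
      unfolding u(2) g_hang[OF u(1)] dE' using u(1) by (cases "u \<in> B") (auto simp: B_def)
    then show ?thesis using v by (auto simp: T_def)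
  qed
  have par: "even (dg E' g v) \<longleftrightarrow> even k \<or> v \<notin> T" if "v \<in> V" for v
  proof (cases "v = None")
    case True
    have "(\<Sum>v\<in>V. dg E' g v) = 2 * int (card E')" by (rule sum_dg_inside[OF finV ends])
    moreover have "(\<Sum>v\<in>V. dg E' g v) = dg E' g None + (\<Sum>v\<in>Some ` U. dg E' g v)"
      using finU by (simp add: V_def)
    moreover have "even (\<Sum>v\<in>Some ` U. dg E' g v) \<longleftrightarrow> even k \<or> even (card (Some ` U \<inter> T))"
      by (rule even_sum_dg[OF _ order_refl parU]) (use finU in auto)
    moreover have "card (Some ` U \<inter> T) = card U" by (simp add: T_def Int_absorb2 card_image)
    ultimately have "even (dg E' g None) \<longleftrightarrow> even k \<or> even (card U)" by (metis dvd_triv_left even_add)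
    then show ?thesis using True by (auto simp: T_def)
  next
    case False
    then show ?thesis using parU that by (auto simp: V_def)
  qed
  \<comment> \<open>The least bound that has the parity of the cuts.\<close>
  define l where "l = (if even k then 2 * int k - 2 else 2 * int k - 1)"
  have l: "2 * int k - 2 \<le> l" "even (l + int k)" by (auto simp: l_def)
  have cutl: "l \<le> cut_card E' g X" if X: "X \<subseteq> V" "None \<notin> X" "odd (card (X \<inter> T))" for X
  proof -
    obtain A where A: "A \<subseteq> U" "X = Some ` A" using X(1,2) by (auto simp: V_def subset_image_iff subset_insert)
    have XT: "X \<inter> T = X" using A by (auto simp: T_def)
    have gX: "g (Inl e) b \<in> X \<longleftrightarrow> a e b \<in> A" for e b
      using A by (auto simp: g_def f_def hang_def image_iff)
    have "cut_card E a A \<le> cut_card E' g X"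
    proof -
      have "cut_card E a A = cut_card (Inl ` E) g X"
        unfolding cut_card_def by (subst sum.reindex) (auto simp: gX)
      also have "\<dots> \<le> cut_card E' g X" unfolding cut_card_def
        by (rule sum_mono2[OF finE']) (auto simp: E'_def)
      finally show ?thesis .
    qed
    moreover have "odd (card A)" using X(3) XT A(2) by (simp add: card_image)
    ultimately have ge: "2 * int k - 2 \<le> cut_card E' g X" using con[OF A(1)] by linarith
    have finX: "finite X" using X(1) finV finite_subset by auto
    have "even (cut_card E' g X) \<longleftrightarrow> even k"
      using sum_dg_cut[OF finX, of E' g] even_sum_dg[OF finX X(1) par] X(3) by auto
    then show ?thesis using ge unfolding l_def by presburger
  qed
  have "l \<le> cut_card E' g X" if X: "X \<subseteq> V" "odd (card (X \<inter> T))" for X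
  proof (cases "None \<in> X")
    case False
    then show ?thesis using cutl X by blast
  next
    case True
    have finT: "finite T" using TV finV finite_subset by auto
    have "even (card T)"
    proof (cases "odd (card U)")
      case True
      then have "T = insert None (Some ` U)" by (auto simp: T_def)
      then show ?thesis using True finU by (simp add: card_image)
    qed (simp add: T_def card_image)
    moreover have "T = X \<inter> T \<union> (V - X) \<inter> T" using TV by auto
    then have "card T = card (X \<inter> T) + card ((V - X) \<inter> T)"
      using card_Un_disjoint[of "X \<inter> T" "(V - X) \<inter> T"] finT by fastforce
    ultimately have "odd (card ((V - X) \<inter> T))" using X(2) by (metis even_add)
    then have "l \<le> cut_card E' g (V - X)" using True by (intro cutl) auto
    then show ?thesis using cut_compl[of E' g V X] ends by simp
  qed
  from parity_colouring[OF k l finE' finV ends TV par this] obtain c where c: "\<forall>x. c x < k"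
    "\<forall>v\<in>V. \<forall>i<k. odd (dg {x \<in> E'. c x = i} g v) \<longleftrightarrow> v \<in> T" by blast
  have odd: "odd (dg {x \<in> E'. c x = i} (hang a) v)" if v: "v \<in> Some ` U" and i: "i < k" for v i
  proof -
    obtain u where u: "u \<in> U" "v = Some u" using v by auto
    have "v \<in> V" "v \<in> T" using u by (auto simp: V_def T_def)
    then show ?thesis using c(2) i g_hang[OF u(1)] u(2) by auto
  qed
  from balanced_recolouring[OF finE', of c k "Some ` U" "hang a"] obtain c' where
    c': "\<forall>x\<in>E'. c' x < k" "\<forall>v\<in>Some ` U. \<forall>i<k. even (dg {x \<in> E'. c' x = i} (hang a) v) \<longleftrightarrow>
        even (dg {x \<in> E'. c x = i} (hang a) v)"
      "\<forall>v. \<forall>i<k. \<forall>j<k. \<bar>dg {x \<in> E'. c' x = i} (hang a) v - dg {x \<in> E'. c' x = j} (hang a) v\<bar> \<le> 2"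
    using c(1) odd by auto
  have "dg {e \<in> E. c' (Inl e) = i} a v \<le> int p" if i: "i < k" for v i
  proof -
    define d where "d j = dg {x \<in> E'. c' x = j} (hang a) (Some v)" for j
    have sum: "(\<Sum>j<k. d j) = dg E a v + of_bool (v \<in> B)"
      unfolding d_def dE'[symmetric] by (rule sum_colour_dg) (use c'(1) finE' in auto)
    have "d i - 2 \<le> d j" if "j < k" for j
    proof -
      have "\<bar>d i - d j\<bar> \<le> 2" using c'(3) i that unfolding d_def by blast
      then show ?thesis by linarith
    qed
    then have window: "int k * (d i - 2) + 2 \<le> dg E a v + of_bool (v \<in> B)"
      using sum_window[OF i, of d] sum by fastforce
    have low: "int k * (x - 2) \<le> int k * (d i - 2)" if "x \<le> d i" for x
      using that by (intro mult_left_mono) auto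
    have "d i \<le> int p"
    proof (cases "v \<in> U")
      case True
      have "dg E a v + of_bool (v \<in> B) \<le> int (k * p)"
      proof (cases "v \<in> B")
        case True
        then have "odd (dg E a v + int k)" by (simp add: B_def)
        moreover have "even (int (k * p) + int k)" using p by auto
        ultimately have "dg E a v \<noteq> int (k * p)" by auto
        then show ?thesis using full[OF \<open>v \<in> U\<close>] True by simp
      qed (use full[OF True] in simp)
      then have "\<not> int p + 2 \<le> d i" using window low[of "int p + 2"] by auto
      moreover have "odd (d i)" using c'(2) odd[of "Some v" i] True i by (simp add: d_def)
      ultimately show ?thesis using p by (cases "d i = int p + 1") auto
    next
      case False
      then have "int k * (d i - 2) + 2 \<le> int (k * p) - int k + 1"
        using window slack[OF False] by (simp add: B_def)
      then have "\<not> int p + 1 \<le> d i" using low[of "int p + 1"] by (auto simp: algebra_simps)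
      then show ?thesis by linarith
    qed
    moreover have "dg {e \<in> E. c' (Inl e) = i} a v \<le> d i"
      unfolding d_def E'_def dg_hang_colour[OF finE finB] by simp
    ultimately show ?thesis by linarith
  qed
  then show ?thesis using c'(1) by (intro exI[of _ "\<lambda>e. c' (Inl e)"]) (auto simp: E'_def)
qed

section \<open>Sharing out the classes\<close>

lemma assign_with_quotas:
  fixes s :: "'i \<Rightarrow> nat"
  assumes "finite I" "(\<Sum>i\<in>I. s i) = r"
  shows "\<exists>\<phi>. (\<forall>j<r. \<phi> j \<in> I) \<and> (\<forall>i\<in>I. card {j. j < r \<and> \<phi> j = i} \<le> s i)"
proof -
  have "card (SIGMA i:I. {..<s i}) = r" using assms by simp
  then obtain h where h: "bij_betw h {0..<r} (SIGMA i:I. {..<s i})"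
    using ex_bij_betw_nat_finite[of "SIGMA i:I. {..<s i}"] assms(1) by auto
  have "card {j. j < r \<and> fst (h j) = i} \<le> s i" if "i \<in> I" for i
  proof -
    have inj: "inj_on h {j. j < r \<and> fst (h j) = i}"
      by (rule inj_on_subset[OF bij_betw_imp_inj_on[OF h]]) auto
    have "h ` {j. j < r \<and> fst (h j) = i} \<subseteq> {i} \<times> {..<s i}"
    proof
      fix y assume "y \<in> h ` {j. j < r \<and> fst (h j) = i}"
      then obtain j where j: "j < r" "fst (h j) = i" "y = h j" by auto
      have "h j \<in> (SIGMA i:I. {..<s i})" using bij_betw_apply[OF h, of j] j(1) by simp
      then show "y \<in> {i} \<times> {..<s i}" using j by (cases "h j") auto
    qed
    then have "card (h ` {j. j < r \<and> fst (h j) = i}) \<le> card ({i} \<times> {..<s i})" by (intro card_mono) auto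
    then show ?thesis using card_image[OF inj] by simp
  qed
  moreover have "fst (h j) \<in> I" if "j < r" for j
  proof -
    have "h j \<in> (SIGMA i:I. {..<s i})" using bij_betw_apply[OF h, of j] that by simp
    then show ?thesis by auto
  qed
  ultimately show ?thesis by (intro exI[of _ "\<lambda>j. fst (h j)"]) auto
qed

text \<open>
  If \<open>\<Delta> i\<close> is odd, then it is at least \<open>p\<close>, because \<open>p - 1\<close> is even. So there are at most \<open>k\<close> odd
  numbers \<open>\<Delta> i\<close>, and each of these indices receives one of the given classes. The number of remaining
  classes is even, since \<open>k p\<close> is the sum of the \<open>\<Delta> i\<close>; therefore their union splits into classes of
  maximum degree 2, just as many as are required to fill up all indices.
\<close>

lemma redistribute_classes:
  fixes a :: "'e \<Rightarrow> bool \<Rightarrow> 'v" and k p :: nat and \<Delta> :: "'i \<Rightarrow> nat"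
  assumes finE: "finite E" and finI: "finite I" and p: "odd p"
    and \<Delta>: "\<And>i. i \<in> I \<Longrightarrow> p - 1 \<le> \<Delta> i" "k * p = (\<Sum>i\<in>I. \<Delta> i)"
    and c: "\<And>e. e \<in> E \<Longrightarrow> c e < k" "\<And>v i. i < k \<Longrightarrow> dg {e \<in> E. c e = i} a v \<le> int p"
  shows "\<exists>h. (\<forall>e\<in>E. h e \<in> I) \<and> (\<forall>v. \<forall>i\<in>I. dg {e \<in> E. h e = i} a v \<le> int (\<Delta> i))"
proof -
  define O' where "O' = {i \<in> I. odd (\<Delta> i)}"
  define t where "t = card O'"
  have finO: "finite O'" "O' \<subseteq> I" using finI by (auto simp: O'_def)
  have p0: "0 < p" using p by (cases p) auto
  have big: "p \<le> \<Delta> i" if "i \<in> O'" for i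
  proof -
    have "odd (\<Delta> i)" "p - 1 \<le> \<Delta> i" using that \<Delta>(1) by (auto simp: O'_def)
    moreover have "even (p - 1)" using p by simp
    ultimately have "\<Delta> i \<noteq> p - 1" by metis
    then show ?thesis using \<open>p - 1 \<le> \<Delta> i\<close> by simp
  qed
  have "t * p = (\<Sum>i\<in>O'. p)" by (simp add: t_def)
  also have "\<dots> \<le> (\<Sum>i\<in>O'. \<Delta> i)" by (rule sum_mono) (rule big)
  also have "\<dots> \<le> (\<Sum>i\<in>I. \<Delta> i)" by (rule sum_mono2) (use finI finO in auto)
  finally have "t * p \<le> k * p" using \<Delta>(2) by simp
  then have tk: "t \<le> k" using p0 by simp
  have "even (k * p) \<longleftrightarrow> even t" unfolding \<Delta>(2) even_sum_iff[OF finI] by (simp add: t_def O'_def)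
  then have "even (k - t)" using p tk by simp
  then obtain r0 where r0: "k - t = 2 * r0" by (elim evenE)
  define r where "r = r0 * p"
  have r: "(k - t) * p = 2 * r" by (simp add: r0 r_def)
  define R where "R = {e \<in> E. t \<le> c e}"
  have finR: "finite R" using finE by (simp add: R_def)
  have dR: "dg R a v \<le> 2 * int r" for v
  proof -
    have "dg R a v = (\<Sum>i\<in>{t..<k}. dg {e \<in> R. c e = i} a v)"
      by (rule sum_colour_dg[symmetric]) (use finR c(1) in \<open>auto simp: R_def\<close>)
    also have "\<dots> \<le> (\<Sum>i\<in>{t..<k}. int p)"
    proof (rule sum_mono)
      fix i assume i: "i \<in> {t..<k}"
      have "{e \<in> R. c e = i} = {e \<in> E. c e = i}" using i by (auto simp: R_def)
      then show "dg {e \<in> R. c e = i} a v \<le> int p" using c(2)[of i v] i by simp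
    qed
    also have "\<dots> = int ((k - t) * p)" by simp
    finally show ?thesis unfolding r by simp
  qed
  obtain c2 where c2: "\<And>e. e \<in> R \<Longrightarrow> c2 e < r" "\<And>v j. j < r \<Longrightarrow> dg {e \<in> R. c2 e = j} a v \<le> 2"
    using degree_two_classes[OF finR dR] by blast
  obtain w where w: "bij_betw w {0..<t} O'" using ex_bij_betw_nat_finite[OF finO(1)] by (auto simp: t_def)
  define s where "s i = (\<Delta> i - (if i \<in> O' then p else 0)) div 2" for i
  have s: "2 * s i + (if i \<in> O' then p else 0) = \<Delta> i" if "i \<in> I" for i
  proof (cases "i \<in> O'")
    case True
    then have "even (\<Delta> i - p)" using p big[OF True] by (auto simp: O'_def)
    then show ?thesis using True big[OF True] by (simp add: s_def)
  next
    case False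
    then show ?thesis using that by (simp add: s_def O'_def)
  qed
  have "(\<Sum>i\<in>I. s i) = r"
  proof -
    have "(\<Sum>i\<in>I. \<Delta> i) = (\<Sum>i\<in>I. 2 * s i + (if i \<in> O' then p else 0))" by (rule sum.cong) (use s in auto)
    also have "\<dots> = 2 * (\<Sum>i\<in>I. s i) + t * p"
      using finI finO(2) by (simp add: sum.distrib sum_distrib_left t_def sum.If_cases Int_absorb1)
    finally have "k * p = 2 * (\<Sum>i\<in>I. s i) + t * p" using \<Delta>(2) by simp
    then show ?thesis using r tk by (simp add: diff_mult_distrib)
  qed
  from assign_with_quotas[OF finI this] obtain \<phi> where
    \<phi>: "\<And>j. j < r \<Longrightarrow> \<phi> j \<in> I" "\<And>i. i \<in> I \<Longrightarrow> card {j. j < r \<and> \<phi> j = i} \<le> s i" by blast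
  define h where "h e = (if c e < t then w (c e) else \<phi> (c2 e))" for e
  have "h e \<in> I" if "e \<in> E" for e
    using that w finO(2) \<phi>(1) c2(1)[of e] by (auto simp: h_def R_def bij_betw_def)
  moreover have "dg {e \<in> E. h e = i} a v \<le> int (\<Delta> i)" if i: "i \<in> I" for v i
  proof -
    let ?A = "{e \<in> E. c e < t \<and> w (c e) = i}" and ?B = "{e \<in> R. \<phi> (c2 e) = i}"
    have "{e \<in> E. h e = i} = ?A \<union> ?B" by (auto simp: h_def R_def)
    moreover have "dg (?A \<union> ?B) a v = dg ?A a v + dg ?B a v"
      by (rule wdeg_Un) (use finE finR in \<open>auto simp: R_def\<close>)
    moreover have "dg ?A a v \<le> (if i \<in> O' then int p else 0)"
    proof (cases "i \<in> O'")
      case True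
      then obtain j where j: "j < t" "w j = i" using w by (force simp: bij_betw_def)
      have "?A = {e \<in> E. c e = j}" using w j by (auto simp: bij_betw_def inj_on_def)
      then show ?thesis using c(2)[of j v] j(1) tk True by simp
    next
      case False
      then have A: "?A = {}" using w by (auto simp: bij_betw_def)
      show ?thesis unfolding A using False by simp
    qed
    moreover have "dg ?B a v \<le> 2 * int (s i)"
    proof -
      let ?J = "{j. j < r \<and> \<phi> j = i}"
      have "dg ?B a v = (\<Sum>j\<in>?J. dg {e \<in> ?B. c2 e = j} a v)"
        by (rule sum_colour_dg[symmetric]) (use finR c2(1) in auto)
      also have "\<dots> \<le> (\<Sum>j\<in>?J. 2)"
      proof (rule sum_mono)
        fix j assume j: "j \<in> ?J"
        then have "{e \<in> ?B. c2 e = j} = {e \<in> R. c2 e = j}" by auto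
        then show "dg {e \<in> ?B. c2 e = j} a v \<le> 2" using c2(2)[of j v] j by simp
      qed
      also have "\<dots> \<le> 2 * int (s i)" using \<phi>(2)[OF i] by simp
      finally show ?thesis .
    qed
    ultimately show ?thesis using s[OF i] by (auto split: if_splits)
  qed
  ultimately show ?thesis by blast
qed

section \<open>Decomposition into factors\<close>

lemma degree_eq_dg:
  assumes "finite (edges H)" "\<And>e. e \<in> edges H \<Longrightarrow> ends H e = Upair (a e True) (a e False)"
  shows "int (degree H v) = dg (edges H) a v"
proof -
  have "{e \<in> edges H. v \<in> set_uprod (ends H e)} = {e \<in> edges H. a e True = v \<or> a e False = v}"
    "{e \<in> edges H. ends H e = Upair v v} = {e \<in> edges H. a e True = v \<and> a e False = v}"
    using assms(2) by auto
  moreover have "int (card {e \<in> edges H. P e}) = (\<Sum>e\<in>edges H. if P e then 1 else 0)" for P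
    using assms(1) by (simp add: sum.If_cases Int_def)
  ultimately show ?thesis
    unfolding degree_def wdeg_def of_nat_add by (simp add: sum.distrib[symmetric]) (rule sum.cong, auto)
qed

lemma cut_size_eq_cut_card:
  assumes "finite (edges G)" "\<And>e. ends G e = Upair (a e True) (a e False)"
  shows "int (cut_size G A) = cut_card (edges G) a A"
proof -
  have "{e \<in> edges G. \<exists>u w. u \<in> A \<and> w \<notin> A \<and> ends G e = Upair u w} =
      {e \<in> edges G. (a e True \<in> A) \<noteq> (a e False \<in> A)}"
    unfolding assms(2) by auto
  then show ?thesis using assms(1) by (simp add: cut_size_def cut_card_def Int_def)
qed

theorem corollary6p12:
  fixes G :: "('v, 'e) mgraph" and k p m :: nat and \<Delta> :: "nat \<Rightarrow> nat" and V\<^sub>1 :: "'v set"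
  assumes "k \<ge> 1"
    and "odd p" and "p \<ge> 3"
    and "\<And>i. i \<in> {1..m} \<Longrightarrow> \<Delta> i \<ge> 1"
    and "\<And>i. i \<in> {1..m} \<Longrightarrow> \<Delta> i \<ge> p - 1"
    and "k * p = (\<Sum>i=1..m. \<Delta> i)"
    and "multigraph G"
    and "even (card (verts G))"
    and "max_degree G \<le> (\<Sum>i=1..m. \<Delta> i)"
    and "V\<^sub>1 = {v \<in> verts G. degree G v \<ge> k * p - k + 2}"
    and "partially_odd_edge_connected G V\<^sub>1 (3 * k - 3) V\<^sub>1"
  shows "\<exists>H. edge_decomposed_into G {1..m} H \<and> (\<forall>i\<in>{1..m}. max_degree (H i) \<le> \<Delta> i)"
proof -
  interpret multigraph G by fact
  have "\<exists>f. ends G e = Upair (f True) (f False)" for e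
  proof (cases "ends G e")
    case (Upair x y)
    then show ?thesis by (intro exI[of _ "\<lambda>b. if b then x else y"]) simp
  qed
  then obtain a where a: "\<And>e. ends G e = Upair (a e True) (a e False)" by metis
  have deg: "dg (edges G) a v = int (degree G v)" for v
    using degree_eq_dg[OF finite_edges a] by simp
  have max: "degree G v \<le> k * p" if "v \<in> verts G" for v
  proof -
    have "degree G v \<le> max_degree G" unfolding max_degree_def using finite_verts that by (intro Max_ge) auto
    then show ?thesis using assms(6,9) by simp
  qed
  have kp: "k \<le> k * p" using assms(3) by simp
  have "\<exists>c. (\<forall>e\<in>edges G. c e < k) \<and> (\<forall>v. \<forall>i<k. dg {e \<in> edges G. c e = i} a v \<le> int p)"
  proof (rule odd_degree_classes[OF assms(1,2) finite_edges])
    show "finite V\<^sub>1" using finite_verts assms(10) by simp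
    show "dg (edges G) a v \<le> int (k * p)" if "v \<in> V\<^sub>1" for v
    proof -
      have "v \<in> verts G" using that assms(10) by simp
      from max[OF this] show ?thesis unfolding deg by (simp only: of_nat_le_iff)
    qed
    show "dg (edges G) a v \<le> int (k * p) - int k + 1" if "v \<notin> V\<^sub>1" for v
    proof (cases "v \<in> verts G")
      case True
      then have "degree G v \<le> k * p - k + 1" using that assms(10) by auto
      then show ?thesis using kp unfolding deg by linarith
    next
      case False
      have "dg (edges G) a v = 0"
        by (rule wdeg_untouched) (use False ends_in_verts a in \<open>metis (full_types) insert_subset set_uprod_simps\<close>)
      then show ?thesis using kp by linarith
    qed
    show "2 * int k - 2 \<le> cut_card (edges G) a A" if "A \<subseteq> V\<^sub>1" "odd (card A)" for A
    proof -
      have "3 * k - 3 \<le> cut_size G A"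
        using assms(11) that by (auto simp: partially_odd_edge_connected_def Int_absorb2)
      then show ?thesis using cut_size_eq_cut_card[OF finite_edges a, of A] assms(1) by linarith
    qed
  qed
  then obtain c where c: "\<And>e. e \<in> edges G \<Longrightarrow> c e < k"
    "\<And>v i. i < k \<Longrightarrow> dg {e \<in> edges G. c e = i} a v \<le> int p" by blast
  obtain h where h: "\<And>e. e \<in> edges G \<Longrightarrow> h e \<in> {1..m}"
    "\<And>v i. i \<in> {1..m} \<Longrightarrow> dg {e \<in> edges G. h e = i} a v \<le> int (\<Delta> i)"
    using redistribute_classes[OF finite_edges finite_atLeastAtMost assms(2,5,6) c] by blast
  define H where "H i = \<lparr>verts = verts G, edges = {e \<in> edges G. h e = i}, ends = ends G\<rparr>" for i
  have "edge_decomposed_into G {1..m} H"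
    using h(1) by (auto simp: edge_decomposed_into_def is_factor_def H_def disjoint_family_on_def)
  moreover have "max_degree (H i) \<le> \<Delta> i" if i: "i \<in> {1..m}" for i
  proof -
    have "degree (H i) v \<le> \<Delta> i" for v
      using degree_eq_dg[of "H i" a v] a h(2)[OF i, of v] finite_edges by (simp add: H_def)
    then show ?thesis unfolding max_degree_def using finite_verts by (simp add: H_def)
  qed
  ultimately show ?thesis by blast
qed

end
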